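(* Let $N\ge2$, $L>0$, and let $\gamma\in C^2([0,L])$ satisfy $0<\alpha_0\le\gamma\le\alpha_1<1$, $\dot\gamma(L)\le0$ and $\ddot\gamma\ge\alpha_2>0$ on $[0,L]$ for some positive numbers $\alpha_0,\alpha_1,\alpha_2$. For $\epsilon>0$ let $g_\epsilon=\gamma^{1/\epsilon}$, let $R_\epsilon=\{(x_1,x')\in\mathbb{R}\times\mathbb{R}^{N-1}:0<x_1<L,\ |x'|<g_\epsilon(x_1)\}$, and let $\tau_\epsilon$ be the first eigenvalue of $-\Delta$ in $R_\epsilon$ with Dirichlet condition on $\partial R_\epsilon\cap\{x_1=0\}$ and Neumann condition on the rest of $\partial R_\epsilon$. Then there exist positive numbers $\rho_\epsilon$ with $\rho_\epsilon\to+\infty$, $\tau_\epsilon/\rho_\epsilon^2\to+\infty$ and $\alpha_1^{1/\epsilon}\rho_\epsilon\to0$ as $\epsilon\to0$. Moreover, for any such $\rho_\epsilon$, the domain $$\tilde R_\epsilon=\rho_\epsilon R_\epsilon=\{(x_1,x')\in\mathbb{R}\times\mathbb{R}^{N-1}:0<x_1<\rho_\epsilon L,\ |x'|<\rho_\epsilon\, g_\epsilon(x_1/\rho_\epsilon)\}$$ has length $\rho_\epsilon L\to+\infty$, its width function satisfies $0<\rho_\epsilon g_\epsilon(x_1/\rho_\epsilon)\le\alpha_1^{1/\epsilon}\rho_\epsilon\to0$ (uniformly in $0<x_1<\rho_\epsilon L$), and, denoting by $\tilde\tau_\epsilon$ the first eigenvalue of $-\Delta$ in $\tilde R_\epsilon$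 with Dirichlet condition on $\partial\tilde R_\epsilon\cap\{x_1=0\}$ and Neumann condition on the rest of $\partial\tilde R_\epsilon$, one has $\tilde\tau_\epsilon=\tau_\epsilon/\rho_\epsilon^2\to+\infty$ as $\epsilon\to0$.
   Context: A dot denotes the derivative of a function of one variable. For a domain of the form $R=\{(x_1,x')\in\mathbb{R}\times\mathbb{R}^{N-1}:0<x_1<\ell,\ |x'|<g(x_1)\}$ with $\ell>0$ and $g\in C^1([0,\ell])$, $g>0$, and with $\Gamma_0=\partial R\cap\{x_1=0\}$, the first eigenvalue of $-\Delta$ in $R$ with Dirichlet condition on $\Gamma_0$ and Neumann condition on $\partial R\setminus\Gamma_0$ is understood variationally as $$\inf\left\{\frac{\int_{R}|\nabla\phi|^2}{\int_{R}|\phi|^2}:\phi\in H^1(R),\ \phi\neq0,\ \phi=0\text{ on }\Gamma_0\right\}.$$ *)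

theory Defs
  imports "HOL-Analysis.Analysis"
begin

primrec Ck :: "nat \<Rightarrow> ('a::euclidean_space \<Rightarrow> real) \<Rightarrow> bool" where
  "Ck 0 f \<longleftrightarrow> continuous_on UNIV f"
| "Ck (Suc k) f \<longleftrightarrow> (\<forall>x. f differentiable (at x)) \<and>
     (\<forall>b\<in>Basis. Ck k (\<lambda>x. frechet_derivative f (at x) b))"

definition smooth :: "('a::euclidean_space \<Rightarrow> real) \<Rightarrow> bool" where
  "smooth f \<longleftrightarrow> (\<forall>k. Ck k f)"

definition grad :: "('a::euclidean_space \<Rightarrow> real) \<Rightarrow> 'a \<Rightarrow> 'a" where
  "grad f x = (\<Sum>b\<in>Basis. frechet_derivative f (at x) b *\<^sub>R b)"

definition square_integrable :: "'a measure \<Rightarrow> ('a \<Rightarrow> 'b::euclidean_space) \<Rightarrow> bool" where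
  "square_integrable M f \<longleftrightarrow>
     f \<in> borel_measurable M \<and> integrable M (\<lambda>x. (norm (f x))\<^sup>2)"

definition L2_tendsto ::
  "'a measure \<Rightarrow> (nat \<Rightarrow> 'a \<Rightarrow> 'b::euclidean_space) \<Rightarrow> ('a \<Rightarrow> 'b) \<Rightarrow> bool" where
  "L2_tendsto M F f \<longleftrightarrow>
     (\<forall>k. square_integrable M (\<lambda>x. F k x - f x)) \<and>
     (\<lambda>k. \<integral>x. (norm (F k x - f x))\<^sup>2 \<partial>M) \<longlonglongrightarrow> 0"

definition test_function :: "'a::euclidean_space set \<Rightarrow> ('a \<Rightarrow> real) \<Rightarrow> bool" where
  "test_function R \<psi> \<longleftrightarrow> smooth \<psi> \<and>
     compact (closure {x. \<psi> x \<noteq> 0}) \<and> closure {x. \<psi> x \<noteq> 0} \<subseteq> R"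

text \<open>\<open>has_H1_gradient R \<phi> G\<close>: the function \<open>\<phi>\<close> belongs to \<open>H\<^sup>1(R)\<close> and
  its weak gradient is \<open>G\<close> (unique up to null sets for open \<open>R\<close>).\<close>

definition has_H1_gradient ::
  "'a::euclidean_space set \<Rightarrow> ('a \<Rightarrow> real) \<Rightarrow> ('a \<Rightarrow> 'a) \<Rightarrow> bool" where
  "has_H1_gradient R \<phi> G \<longleftrightarrow>
     square_integrable (lebesgue_on R) \<phi> \<and>
     square_integrable (lebesgue_on R) G \<and>
     (\<forall>\<psi>. test_function R \<psi> \<longrightarrow> (\<forall>b\<in>Basis.
        (\<integral>x. \<phi> x * (grad \<psi> x \<bullet> b) \<partial>lebesgue_on R) =
        - (\<integral>x. (G x \<bullet> b) * \<psi> x \<partial>lebesgue_on R)))"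

definition Gamma0 :: "(real \<times> 'a::euclidean_space) set \<Rightarrow> (real \<times> 'a) set" where
  "Gamma0 R = frontier R \<inter> {x. fst x = 0}"

text \<open>The trace on \<open>\<Gamma>\<^sub>0\<close>, i.e. the continuous extension to \<open>H\<^sup>1(R)\<close> of the
  restriction map \<open>\<Phi> \<mapsto> \<Phi>|\<Gamma>\<^sub>0\<close> on \<open>C\<^sup>\<infinity>(closure R)\<close> with values in \<open>L\<^sup>2(\<Gamma>\<^sub>0)\<close>.
  The set \<open>\<Gamma>\<^sub>0\<close> lies in the hyperplane \<open>x\<^sub>1 = 0\<close>, so its surface measure is Lebesgue
  measure in the variable \<open>x'\<close>.  Here \<open>G\<close> is the weak gradient of \<open>\<phi>\<close>.\<close>

definition has_trace ::
  "(real \<times> 'a::euclidean_space) set \<Rightarrow> (real \<times> 'a \<Rightarrow> real) \<Rightarrow>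
     (real \<times> 'a \<Rightarrow> real \<times> 'a) \<Rightarrow> (real \<times> 'a \<Rightarrow> real) \<Rightarrow> bool" where
  "has_trace R \<phi> G t \<longleftrightarrow> (\<exists>\<Phi>. (\<forall>k. smooth (\<Phi> k)) \<and>
     L2_tendsto (lebesgue_on R) \<Phi> \<phi> \<and>
     L2_tendsto (lebesgue_on R) (\<lambda>k. grad (\<Phi> k)) G \<and>
     L2_tendsto (lebesgue_on {y. (0, y) \<in> Gamma0 R}) (\<lambda>k y. \<Phi> k (0, y)) (\<lambda>y. t (0, y)))"

definition first_eigenvalue :: "(real \<times> 'a::euclidean_space) set \<Rightarrow> real" where
  "first_eigenvalue R =
     Inf {(\<integral>x. (norm (G x))\<^sup>2 \<partial>lebesgue_on R) / (\<integral>x. (\<phi> x)\<^sup>2 \<partial>lebesgue_on R) | \<phi> G.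
       has_H1_gradient R \<phi> G \<and> \<not> (AE x in lebesgue_on R. \<phi> x = 0) \<and>
       has_trace R \<phi> G (\<lambda>_. 0)}"

definition thin_domain ::
  "real \<Rightarrow> (real \<Rightarrow> real) \<Rightarrow> (real \<times> 'a::euclidean_space) set" where
  "thin_domain l g = {(x1, x'). 0 < x1 \<and> x1 < l \<and> norm x' < g x1}"

definition admissible_scaling ::
  "real \<Rightarrow> (real \<Rightarrow> real) \<Rightarrow> (real \<Rightarrow> real) \<Rightarrow> bool" where
  "admissible_scaling \<alpha>1 \<tau> \<rho> \<longleftrightarrow>
     (\<forall>\<epsilon>>0. \<rho> \<epsilon> > 0) \<and>
     filterlim \<rho> at_top (at_right 0) \<and>
     filterlim (\<lambda>\<epsilon>. \<tau> \<epsilon> / (\<rho> \<epsilon>)\<^sup>2) at_top (at_right 0) \<and>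
     ((\<lambda>\<epsilon>. \<alpha>1 powr (1 / \<epsilon>) * \<rho> \<epsilon>) \<longlongrightarrow> 0) (at_right 0)"

end

(*
  Idea: let n = N - 1. Convexity of gamma and gamma'(L) <= 0 give gamma'(x) <= -alpha2 (L - x), so
  the cross-sectional weight w = gamma^(n/eps) satisfies w' <= -M (L - x) w with
  M = n alpha2 / (eps alpha1). Integrating the derivative of M (x - L) w v^2 over [0, L] and
  absorbing the cross term yields M int w v^2 <= M L w(0) v(0)^2 + int w v'^2. Applying this along
  the curves x |-> (x, g(x) z), |z| < 1, and integrating over z gives a Poincare inequality on
  R_eps whose boundary term disappears in the limit for functions with zero trace on Gamma_0.
  Hence tau_eps >= const / eps, and rho_eps = eps^(-1/4) is admissible. The exact scaling law for
  the eigenvalue comes from transporting admissible functions by dilations; the set of Rayleigh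
  quotients has to be non-empty for it (the infimum of the empty set is a junk value), which
  the function x_1 shows.
*)
theory Submission
  imports Defs "HOL-Real_Asymp.Real_Asymp"
begin

section \<open>Smooth functions and gradients\<close>

text \<open>The slope bound for gamma degenerates at x = L, where gamma' may vanish, so w need not
  decay at a fixed exponential rate on the whole interval. The multiplier M (x - L) copes with this:
  it vanishes at L, hence leaves no boundary term there, and differentiating its linear factor
  supplies M w v^2 even near L. Segments parallel to the axis would carry no weight; on the curves
  the Jacobian g^n of the substitution y = g(x) z turns the shrinking of the cross-sections into
  decay of w. The curves must not be steep: |g'| is of order alpha1^(1/eps) / eps at most, hence at
  most 1 for small eps. The constant in the lower bound is n alpha2 / (8 alpha1), where 8 = 2 * 2 *
  2 collects one factor from the speed of the curves and two from replacing a function and its weak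
  gradient by smooth approximants. These approximants are the ones that witness the zero trace, so
  their boundary integrals tend to zero.\<close>

lemma Ck_const: "Ck k (\<lambda>_. c)"
  by (induction k arbitrary: c) (auto simp: frechet_derivative_const)

lemma Ck_bounded_linear:
  assumes "bounded_linear f"
  shows "Ck k f"
proof (cases k)
  case 0
  with assms show ?thesis
    by (simp add: linear_continuous_on)
next
  case (Suc m)
  have "frechet_derivative f (at x) = f" for x
    using assms by (metis bounded_linear_imp_has_derivative frechet_derivative_at)
  with Suc assms show ?thesis
    by (simp add: Ck_const bounded_linear_imp_differentiable)
qed

lemma smooth_bounded_linear: "bounded_linear f \<Longrightarrow> smooth f"
  by (simp add: smooth_def Ck_bounded_linear)

lemma has_derivative_rescale:
  fixes f :: "'a::real_normed_vector \<Rightarrow> real"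
  assumes "(f has_derivative f') (at (c *\<^sub>R x))"
  shows "((\<lambda>x. a * f (c *\<^sub>R x)) has_derivative (\<lambda>h. a * f' (c *\<^sub>R h))) (at x)"
proof -
  have "((\<lambda>x. c *\<^sub>R x) has_derivative (\<lambda>h. c *\<^sub>R h)) (at x)"
    by (rule bounded_linear_imp_has_derivative[OF bounded_linear_scaleR_right])
  then have "((\<lambda>x. f (c *\<^sub>R x)) has_derivative (\<lambda>h. f' (c *\<^sub>R h))) (at x)"
    by (rule has_derivative_compose) (fact assms)
  then show ?thesis
    by (rule has_derivative_mult_right)
qed

text \<open>Each differentiation brings out a factor c by the chain rule, so the induction runs with
  an arbitrary prefactor \<open>a\<close> that absorbs it; \<open>smooth_rescale\<close> is the case
  a = 1.\<close>

lemma Ck_rescale: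
  assumes "Ck k f"
  shows "Ck k (\<lambda>x. a * f (c *\<^sub>R x))"
  using assms
proof (induction k arbitrary: f a)
  case 0
  then have "continuous_on UNIV f" by simp
  then have "continuous_on UNIV (\<lambda>x. f (c *\<^sub>R x))"
    by (rule continuous_on_compose2) (auto intro: continuous_intros)
  then show ?case by (auto intro: continuous_intros)
next
  case (Suc k)
  have f: "(f has_derivative frechet_derivative f (at x)) (at x)" for x
    using Suc.prems by (simp add: frechet_derivative_works)
  have g: "((\<lambda>x. a * f (c *\<^sub>R x)) has_derivative
      (\<lambda>h. a * frechet_derivative f (at (c *\<^sub>R x)) (c *\<^sub>R h))) (at x)" for x
    by (rule has_derivative_rescale[OF f])
  have "frechet_derivative (\<lambda>x. a * f (c *\<^sub>R x)) (at x) b =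
      (a * c) * frechet_derivative f (at (c *\<^sub>R x)) b" for x b
    unfolding frechet_derivative_at[OF g, symmetric]
    by (simp add: linear_cmul[OF has_derivative_linear[OF f]])
  then have "Ck k (\<lambda>x. frechet_derivative (\<lambda>x. a * f (c *\<^sub>R x)) (at x) b)" if "b \<in> Basis" for b
    using Suc.IH[of "\<lambda>x. frechet_derivative f (at x) b" "a * c"] Suc.prems that by simp
  then show ?case
    using g by (auto simp: differentiable_def)
qed

lemma smooth_rescale: "smooth f \<Longrightarrow> smooth (\<lambda>x. f (c *\<^sub>R x))"
  unfolding smooth_def using Ck_rescale[of _ f 1 c] by simp

text \<open>By linearity the Frechet derivative is fixed by its values on \<open>Basis\<close>, and
  these are the coordinates of \<open>grad f x\<close>. Later chain and product rules are computed
  in this inner-product form.\<close>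

lemma smooth_has_derivative:
  assumes "smooth f"
  shows "(f has_derivative (\<lambda>h. grad f x \<bullet> h)) (at x)"
proof -
  from assms have "Ck (Suc 0) f" by (simp add: smooth_def)
  then have f: "(f has_derivative frechet_derivative f (at x)) (at x)"
    by (simp add: frechet_derivative_works)
  interpret linear "frechet_derivative f (at x)"
    using f by (rule has_derivative_linear)
  have "frechet_derivative f (at x) h = grad f x \<bullet> h" for h
  proof -
    have "frechet_derivative f (at x) h =
        frechet_derivative f (at x) (\<Sum>b\<in>Basis. (h \<bullet> b) *\<^sub>R b)"
      by (simp add: euclidean_representation)
    also have "\<dots> = grad f x \<bullet> h"
      by (simp add: sum scale grad_def inner_sum_left inner_commute[of h] mult.commute)
    finally show ?thesis .
  qed
  with f show ?thesis
    by (metis (no_types, lifting) ext)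
qed

lemma grad_eqI:
  assumes "(f has_derivative (\<lambda>h. v \<bullet> h)) (at x)"
  shows "grad f x = v"
  unfolding grad_def frechet_derivative_at[OF assms, symmetric] by (rule euclidean_representation)

lemma smooth_continuous: "smooth f \<Longrightarrow> continuous_on UNIV f"
  unfolding smooth_def by (metis Ck.simps(1))

lemma smooth_continuous_grad:
  assumes "smooth f"
  shows "continuous_on UNIV (grad f)"
proof -
  from assms have "Ck (Suc 0) f" by (simp add: smooth_def)
  then show ?thesis
    unfolding grad_def[abs_def] by (auto intro!: continuous_intros)
qed

lemma grad_rescale:
  assumes "smooth f"
  shows "grad (\<lambda>x. f (c *\<^sub>R x)) x = c *\<^sub>R grad f (c *\<^sub>R x)"
  using has_derivative_rescale[OF smooth_has_derivative[OF assms], where a = 1]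
  by (intro grad_eqI) simp

section \<open>Dilations\<close>

lemma lebesgue_eq_dilation:
  assumes "c \<noteq> 0"
  shows "(lebesgue :: 'a::euclidean_space measure) =
    density (distr lebesgue lebesgue ((*\<^sub>R) c)) (\<lambda>_. ennreal (\<bar>c\<bar> ^ DIM('a)))"
proof -
  \<comment> \<open>\<open>lebesgue_affine_euclidean\<close> scales every coordinate by its own
    factor; for equal factors its sum collapses to \<open>c *\<^sub>R x\<close>.\<close>
  have [simp]: "(\<Sum>j\<in>Basis. (c * (x \<bullet> j)) *\<^sub>R j) = c *\<^sub>R x" for x :: 'a
    unfolding scaleR_scaleR[symmetric] scaleR_sum_right[symmetric] euclidean_representation ..
  show ?thesis
    using lebesgue_affine_euclidean[of "\<lambda>_::'a. c" 0] assms by (simp add: ennreal_power)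
qed

lemma dilation_image_sets_lebesgue:
  fixes R :: "'a::euclidean_space set"
  assumes "c \<noteq> 0" "R \<in> sets lebesgue"
  shows "(*\<^sub>R) c ` R \<in> sets lebesgue"
proof -
  have "(*\<^sub>R) c ` R = (*\<^sub>R) (1 / c) -` R"
    using assms(1) by (force simp: image_iff)
  then show ?thesis
    using measurable_sets[OF lebesgue_measurable_scaling assms(2), of "1 / c"] by simp
qed

lemma measurable_dilation:
  fixes R :: "'a::euclidean_space set"
  assumes "c \<noteq> 0" "f \<in> lebesgue_on R \<rightarrow>\<^sub>M N"
  shows "(\<lambda>x. f (x /\<^sub>R c)) \<in> lebesgue_on ((*\<^sub>R) c ` R) \<rightarrow>\<^sub>M N"
proof -
  have "(*\<^sub>R) (inverse c) \<in> lebesgue_on ((*\<^sub>R) c ` R) \<rightarrow>\<^sub>M lebesgue_on R"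
    by (rule measurable_restrict_space3) (use assms(1) in auto)
  from measurable_comp[OF this assms(2)] show ?thesis
    by (simp add: o_def)
qed

text \<open>The change of variables is available on the whole space, so f is first cut off outside
  the dilated set. After substituting c x the cutoff \<open>h\<close> becomes the indicator of R
  times f, and the density contributes the Jacobian.\<close>

lemma
  fixes R :: "'a::euclidean_space set" and f :: "'a \<Rightarrow> 'b::euclidean_space"
  assumes c: "c > 0" and R: "R \<in> sets lebesgue" and f: "f \<in> borel_measurable (lebesgue_on R)"
  shows integrable_dilation: "integrable (lebesgue_on ((*\<^sub>R) c ` R)) (\<lambda>x. f (x /\<^sub>R c)) \<longleftrightarrow>
      integrable (lebesgue_on R) f"
    and integral_dilation: "(\<integral>x. f (x /\<^sub>R c) \<partial>lebesgue_on ((*\<^sub>R) c ` R)) =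
      c ^ DIM('a) *\<^sub>R (\<integral>x. f x \<partial>lebesgue_on R)"
proof -
  have cR: "(*\<^sub>R) c ` R \<in> sets lebesgue"
    using c R by (intro dilation_image_sets_lebesgue) auto
  define h where "h = (\<lambda>x. indicator ((*\<^sub>R) c ` R) x *\<^sub>R f (x /\<^sub>R c))"
  have h[measurable]: "h \<in> borel_measurable lebesgue"
    unfolding h_def using measurable_dilation[of c f R borel] c f cR
    by (subst borel_measurable_restrict_space_iff[symmetric]) auto
  have hc: "h (c *\<^sub>R x) = indicator R x *\<^sub>R f x" for x
    using c by (auto simp: h_def indicator_def)
  have "integrable (lebesgue_on ((*\<^sub>R) c ` R)) (\<lambda>x. f (x /\<^sub>R c)) \<longleftrightarrow> integrable lebesgue h"
    unfolding h_def using cR by (subst integrable_restrict_space) auto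
  also have "\<dots> \<longleftrightarrow> integrable lebesgue (\<lambda>x. c ^ DIM('a) *\<^sub>R h (c *\<^sub>R x))"
    using c by (subst lebesgue_eq_dilation[of c])
      (simp_all add: integrable_density integrable_distr_eq)
  also have "\<dots> \<longleftrightarrow> integrable lebesgue (\<lambda>x. h (c *\<^sub>R x))"
  proof
    assume "integrable lebesgue (\<lambda>x. c ^ DIM('a) *\<^sub>R h (c *\<^sub>R x))"
    then have "integrable lebesgue (\<lambda>x. inverse (c ^ DIM('a)) *\<^sub>R c ^ DIM('a) *\<^sub>R h (c *\<^sub>R x))"
      by (rule integrable_scaleR_right)
    moreover have "inverse (c ^ DIM('a)) *\<^sub>R c ^ DIM('a) *\<^sub>R y = y" for y :: 'b
      using c by simp
    ultimately show "integrable lebesgue (\<lambda>x. h (c *\<^sub>R x))"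
      by (simp only:)
  qed simp
  also have "\<dots> \<longleftrightarrow> integrable (lebesgue_on R) f"
    using R by (simp add: hc integrable_restrict_space)
  finally show "integrable (lebesgue_on ((*\<^sub>R) c ` R)) (\<lambda>x. f (x /\<^sub>R c)) \<longleftrightarrow>
      integrable (lebesgue_on R) f" .
  have "(\<integral>x. f (x /\<^sub>R c) \<partial>lebesgue_on ((*\<^sub>R) c ` R)) = integral\<^sup>L lebesgue h"
    unfolding h_def using cR by (subst integral_restrict_space) auto
  also have "\<dots> = (\<integral>x. c ^ DIM('a) *\<^sub>R h (c *\<^sub>R x) \<partial>lebesgue)"
    using c by (subst lebesgue_eq_dilation[of c])
      (simp_all add: integral_density integral_distr)
  also have "\<dots> = c ^ DIM('a) *\<^sub>R (\<integral>x. f x \<partial>lebesgue_on R)"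
    using R by (simp add: hc integral_restrict_space del: scaleR_scaleR)
  finally show "(\<integral>x. f (x /\<^sub>R c) \<partial>lebesgue_on ((*\<^sub>R) c ` R)) =
      c ^ DIM('a) *\<^sub>R (\<integral>x. f x \<partial>lebesgue_on R)" .
qed

section \<open>L2 convergence, weak gradients and zero traces under dilations\<close>

lemma square_integrable_dilation:
  fixes R :: "'a::euclidean_space set" and f :: "'a \<Rightarrow> 'b::euclidean_space"
  assumes c: "c > 0" and R: "R \<in> sets lebesgue" and f: "square_integrable (lebesgue_on R) f"
  shows "square_integrable (lebesgue_on ((*\<^sub>R) c ` R)) (\<lambda>x. f (x /\<^sub>R c))"
proof -
  from f have [measurable]: "f \<in> borel_measurable (lebesgue_on R)"
    by (simp add: square_integrable_def)
  show ?thesis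
    using f c measurable_dilation[of c f R borel]
      integrable_dilation[OF c R, of "\<lambda>x. (norm (f x))\<^sup>2"]
    by (simp add: square_integrable_def)
qed

lemma L2_tendsto_dilation:
  fixes R :: "'a::euclidean_space set" and f :: "'a \<Rightarrow> 'b::euclidean_space"
  assumes c: "c > 0" and R: "R \<in> sets lebesgue" and F: "L2_tendsto (lebesgue_on R) F f"
  shows "L2_tendsto (lebesgue_on ((*\<^sub>R) c ` R)) (\<lambda>k x. F k (x /\<^sub>R c)) (\<lambda>x. f (x /\<^sub>R c))"
  unfolding L2_tendsto_def
proof safe
  fix k
  show "square_integrable (lebesgue_on ((*\<^sub>R) c ` R)) (\<lambda>x. F k (x /\<^sub>R c) - f (x /\<^sub>R c))"
    using square_integrable_dilation[OF c R, of "\<lambda>x. F k x - f x"] F by (simp add: L2_tendsto_def)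
next
  have [measurable]: "(\<lambda>x. F k x - f x) \<in> borel_measurable (lebesgue_on R)" for k
    using F by (simp add: L2_tendsto_def square_integrable_def)
  have "(\<integral>x. (norm (F k (x /\<^sub>R c) - f (x /\<^sub>R c)))\<^sup>2 \<partial>lebesgue_on ((*\<^sub>R) c ` R)) =
      c ^ DIM('a) * (\<integral>x. (norm (F k x - f x))\<^sup>2 \<partial>lebesgue_on R)" for k
    using integral_dilation[OF c R, of "\<lambda>x. (norm (F k x - f x))\<^sup>2"] by simp
  moreover have "(\<lambda>k. c ^ DIM('a) * (\<integral>x. (norm (F k x - f x))\<^sup>2 \<partial>lebesgue_on R)) \<longlonglongrightarrow> 0"
    using F by (auto simp: L2_tendsto_def intro: tendsto_mult_right_zero)
  ultimately show
    "(\<lambda>k. \<integral>x. (norm (F k (x /\<^sub>R c) - f (x /\<^sub>R c)))\<^sup>2 \<partial>lebesgue_on ((*\<^sub>R) c ` R)) \<longlonglongrightarrow> 0"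
    by simp
qed

lemma square_integrable_scaleR:
  "square_integrable M f \<Longrightarrow> square_integrable M (\<lambda>x. a *\<^sub>R f x)"
  by (auto simp: square_integrable_def power_mult_distrib)

lemma L2_tendsto_scaleR:
  assumes "L2_tendsto M F f"
  shows "L2_tendsto M (\<lambda>k x. a *\<^sub>R F k x) (\<lambda>x. a *\<^sub>R f x)"
proof -
  have "square_integrable M (\<lambda>x. a *\<^sub>R (F k x - f x))" for k
    using assms by (auto simp: L2_tendsto_def intro: square_integrable_scaleR)
  moreover have "(\<integral>x. (norm (a *\<^sub>R (F k x - f x)))\<^sup>2 \<partial>M) =
      a\<^sup>2 * (\<integral>x. (norm (F k x - f x))\<^sup>2 \<partial>M)" for k
    by (simp add: power_mult_distrib)
  moreover have "(\<lambda>k. a\<^sup>2 * (\<integral>x. (norm (F k x - f x))\<^sup>2 \<partial>M)) \<longlonglongrightarrow> 0"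
    using assms by (auto simp: L2_tendsto_def intro: tendsto_mult_right_zero)
  ultimately show ?thesis
    by (simp add: L2_tendsto_def flip: scaleR_diff_right)
qed

lemma test_function_dilation:
  fixes R :: "'a::euclidean_space set"
  assumes c: "c > 0" and \<psi>: "test_function ((*\<^sub>R) c ` R) \<psi>"
  shows "test_function R (\<lambda>x. \<psi> (c *\<^sub>R x))"
proof -
  have "{x. \<psi> (c *\<^sub>R x) \<noteq> 0} = (*\<^sub>R) (1 / c) ` {x. \<psi> x \<noteq> 0}"
    using c by (force simp: image_iff)
  then have supp: "closure {x. \<psi> (c *\<^sub>R x) \<noteq> 0} = (*\<^sub>R) (1 / c) ` closure {x. \<psi> x \<noteq> 0}"
    by (simp add: closure_scaleR)
  have "closure {x. \<psi> x \<noteq> 0} \<subseteq> (*\<^sub>R) c ` R" "compact (closure {x. \<psi> x \<noteq> 0})" "smooth \<psi>"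
    using \<psi> by (auto simp: test_function_def)
  then show ?thesis
    unfolding test_function_def supp using c
    by (fastforce intro: smooth_rescale compact_scaling)
qed

text \<open>Test functions on the dilated set are pulled back to R. The gradient of the pullback
  carries a factor c, which is matched by dividing \<open>G\<close> by c; the Jacobian is the same
  on both sides of the weak identity.\<close>

lemma has_H1_gradient_dilation:
  fixes R :: "'a::euclidean_space set"
  assumes c: "c > 0" and R: "R \<in> sets lebesgue" and \<phi>: "has_H1_gradient R \<phi> G"
  shows "has_H1_gradient ((*\<^sub>R) c ` R) (\<lambda>x. \<phi> (x /\<^sub>R c)) (\<lambda>x. G (x /\<^sub>R c) /\<^sub>R c)"
  unfolding has_H1_gradient_def
proof (intro conjI allI impI ballI)
  show "square_integrable (lebesgue_on ((*\<^sub>R) c ` R)) (\<lambda>x. \<phi> (x /\<^sub>R c))"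
    using c R \<phi> by (intro square_integrable_dilation) (auto simp: has_H1_gradient_def)
  show "square_integrable (lebesgue_on ((*\<^sub>R) c ` R)) (\<lambda>x. G (x /\<^sub>R c) /\<^sub>R c)"
    using c R \<phi>
    by (intro square_integrable_scaleR square_integrable_dilation) (auto simp: has_H1_gradient_def)
next
  fix \<psi> and b :: 'a
  assume \<psi>: "test_function ((*\<^sub>R) c ` R) \<psi>" and b: "b \<in> Basis"
  define \<eta> where "\<eta> = (\<lambda>x. \<psi> (c *\<^sub>R x))"
  have sm: "smooth \<psi>"
    using \<psi> by (simp add: test_function_def)
  have \<eta>: "test_function R \<eta>"
    unfolding \<eta>_def using c \<psi> by (rule test_function_dilation)
  have "grad \<eta> x = c *\<^sub>R grad \<psi> (c *\<^sub>R x)" for x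
    unfolding \<eta>_def by (rule grad_rescale[OF sm])
  then have grad: "grad \<psi> x = grad \<eta> (x /\<^sub>R c) /\<^sub>R c" for x
    using c by simp
  have sc: "smooth \<eta>"
    using \<eta> by (simp add: test_function_def)
  have [measurable]: "\<phi> \<in> borel_measurable (lebesgue_on R)" "G \<in> borel_measurable (lebesgue_on R)"
    using \<phi> by (auto simp: has_H1_gradient_def square_integrable_def)
  have meas: "f \<in> borel_measurable (lebesgue_on R)" if "continuous_on UNIV f"
    for f :: "'a \<Rightarrow> 'b::euclidean_space"
    using that by (intro continuous_imp_measurable_on_sets_lebesgue R)
      (auto intro: continuous_on_subset)
  have [measurable]: "\<eta> \<in> borel_measurable (lebesgue_on R)" "grad \<eta> \<in> borel_measurable (lebesgue_on R)"
    by (auto intro!: meas smooth_continuous smooth_continuous_grad sc)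
  have "(\<integral>x. \<phi> (x /\<^sub>R c) * (grad \<psi> x \<bullet> b) \<partial>lebesgue_on ((*\<^sub>R) c ` R)) =
      (\<integral>x. (\<lambda>y. \<phi> y * (grad \<eta> y \<bullet> b) / c) (x /\<^sub>R c) \<partial>lebesgue_on ((*\<^sub>R) c ` R))"
    by (simp add: grad field_simps)
  also have "\<dots> = c ^ DIM('a) * (\<integral>y. \<phi> y * (grad \<eta> y \<bullet> b) / c \<partial>lebesgue_on R)"
    by (subst integral_dilation[OF c R]) auto
  also have "(\<integral>y. \<phi> y * (grad \<eta> y \<bullet> b) / c \<partial>lebesgue_on R) =
      - (\<integral>y. (G y \<bullet> b) * \<eta> y / c \<partial>lebesgue_on R)"
    using \<phi> \<eta> b by (simp add: has_H1_gradient_def)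
  also have "c ^ DIM('a) * - (\<integral>y. (G y \<bullet> b) * \<eta> y / c \<partial>lebesgue_on R) =
      - (\<integral>x. (\<lambda>y. (G y \<bullet> b) * \<eta> y / c) (x /\<^sub>R c) \<partial>lebesgue_on ((*\<^sub>R) c ` R))"
    by (subst integral_dilation[OF c R]) auto
  also have "\<dots> = - (\<integral>x. ((G (x /\<^sub>R c) /\<^sub>R c) \<bullet> b) * \<psi> x \<partial>lebesgue_on ((*\<^sub>R) c ` R))"
    using c by (simp add: \<eta>_def field_simps)
  finally show "(\<integral>x. \<phi> (x /\<^sub>R c) * (grad \<psi> x \<bullet> b) \<partial>lebesgue_on ((*\<^sub>R) c ` R)) =
      - (\<integral>x. ((G (x /\<^sub>R c) /\<^sub>R c) \<bullet> b) * \<psi> x \<partial>lebesgue_on ((*\<^sub>R) c ` R))" .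
qed

lemma Gamma0_dilation:
  assumes "c > 0"
  shows "Gamma0 ((*\<^sub>R) c ` R) = (*\<^sub>R) c ` Gamma0 R"
proof -
  have inj: "inj ((*\<^sub>R) c :: real \<times> 'a \<Rightarrow> real \<times> 'a)"
    using assms by (intro injI) (auto simp: scaleR_cancel_left)
  have "frontier ((*\<^sub>R) c ` R) = (*\<^sub>R) c ` frontier R"
    unfolding frontier_def using inj
    by (simp add: closure_scaleR interior_injective_linear_image linear_scaleR image_set_diff)
  then show ?thesis
    using assms by (auto simp: Gamma0_def)
qed

text \<open>Closedness provides the measurability required to rescale and compare integrals over the
  boundary slice.\<close>

lemma closed_Gamma0_slice: "closed {y. (0, y) \<in> Gamma0 R}"
proof -
  have "closed ((\<lambda>y. (0, y)) -` frontier R)"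
    by (intro continuous_closed_vimage) (auto intro: continuous_intros)
  then show ?thesis
    by (simp add: Gamma0_def vimage_def)
qed

text \<open>The approximants are composed with the inverse dilation. The slice has one dimension
  less than R, so its integrals pick up a different power of c, but convergence to zero survives any
  constant factor.\<close>

lemma has_trace_zero_dilation:
  fixes R :: "(real \<times> 'a::euclidean_space) set"
  assumes c: "c > 0" and R: "R \<in> sets lebesgue" and \<phi>: "has_trace R \<phi> G (\<lambda>_. 0)"
  shows "has_trace ((*\<^sub>R) c ` R) (\<lambda>x. \<phi> (x /\<^sub>R c)) (\<lambda>x. G (x /\<^sub>R c) /\<^sub>R c) (\<lambda>_. 0)"
proof -
  obtain \<Phi> where sm: "\<And>k. smooth (\<Phi> k)" and \<Phi>: "L2_tendsto (lebesgue_on R) \<Phi> \<phi>"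
    and G: "L2_tendsto (lebesgue_on R) (\<lambda>k. grad (\<Phi> k)) G"
    and tr: "L2_tendsto (lebesgue_on {y. (0, y) \<in> Gamma0 R}) (\<lambda>k y. \<Phi> k (0, y)) (\<lambda>_. 0)"
    using \<phi> by (auto simp: has_trace_def)
  let ?\<Phi> = "\<lambda>k x. \<Phi> k (x /\<^sub>R c)"
  have slice: "{y. (0, y) \<in> Gamma0 ((*\<^sub>R) c ` R)} = (*\<^sub>R) c ` {y. (0, y) \<in> Gamma0 R}"
    using c by (force simp: Gamma0_dilation image_iff)
  have "L2_tendsto (lebesgue_on ((*\<^sub>R) c ` R)) ?\<Phi> (\<lambda>x. \<phi> (x /\<^sub>R c))"
    using L2_tendsto_dilation[OF c R \<Phi>] .
  moreover have "L2_tendsto (lebesgue_on ((*\<^sub>R) c ` R)) (\<lambda>k. grad (?\<Phi> k)) (\<lambda>x. G (x /\<^sub>R c) /\<^sub>R c)"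
    unfolding grad_rescale[OF sm, abs_def]
    by (rule L2_tendsto_scaleR[OF L2_tendsto_dilation[OF c R G]])
  moreover have "L2_tendsto (lebesgue_on {y. (0, y) \<in> Gamma0 ((*\<^sub>R) c ` R)})
      (\<lambda>k y. ?\<Phi> k (0, y)) (\<lambda>_. 0)"
    unfolding slice using L2_tendsto_dilation[OF c _ tr] closed_Gamma0_slice[of R]
    by (simp add: borel_closed sets_completionI_sets)
  ultimately show ?thesis
    unfolding has_trace_def using smooth_rescale[OF sm]
    by (intro exI[of _ ?\<Phi>]) blast
qed

section \<open>Rayleigh quotients\<close>

definition rayleigh_quotients :: "(real \<times> 'a::euclidean_space) set \<Rightarrow> real set" where
  "rayleigh_quotients R =
     {(\<integral>x. (norm (G x))\<^sup>2 \<partial>lebesgue_on R) / (\<integral>x. (\<phi> x)\<^sup>2 \<partial>lebesgue_on R) | \<phi> G.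
       has_H1_gradient R \<phi> G \<and> \<not> (AE x in lebesgue_on R. \<phi> x = 0) \<and>
       has_trace R \<phi> G (\<lambda>_. 0)}"

lemma first_eigenvalue_eq: "first_eigenvalue R = Inf (rayleigh_quotients R)"
  by (simp add: first_eigenvalue_def rayleigh_quotients_def)

lemma rayleigh_quotients_nonneg: "q \<in> rayleigh_quotients R \<Longrightarrow> 0 \<le> q"
  by (auto simp: rayleigh_quotients_def)

text \<open>Numerator and denominator share the Jacobian, which cancels; what remains is the 1/c^2
  from the rescaled gradient.\<close>

lemma rayleigh_quotients_dilation:
  fixes R :: "(real \<times> 'a::euclidean_space) set"
  assumes c: "c > 0" and R: "R \<in> sets lebesgue" and q: "q \<in> rayleigh_quotients R"
  shows "q / c\<^sup>2 \<in> rayleigh_quotients ((*\<^sub>R) c ` R)"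
proof -
  obtain \<phi> G where q_eq: "q = (\<integral>x. (norm (G x))\<^sup>2 \<partial>lebesgue_on R) / (\<integral>x. (\<phi> x)\<^sup>2 \<partial>lebesgue_on R)"
    and H1: "has_H1_gradient R \<phi> G" and nz: "\<not> (AE x in lebesgue_on R. \<phi> x = 0)"
    and tr: "has_trace R \<phi> G (\<lambda>_. 0)"
    using q by (auto simp: rayleigh_quotients_def)
  have [measurable]: "\<phi> \<in> borel_measurable (lebesgue_on R)" "G \<in> borel_measurable (lebesgue_on R)"
    and int: "integrable (lebesgue_on R) (\<lambda>x. (\<phi> x)\<^sup>2)"
    using H1 by (auto simp: has_H1_gradient_def square_integrable_def)
  have int_\<phi>: "(\<integral>x. (\<phi> (x /\<^sub>R c))\<^sup>2 \<partial>lebesgue_on ((*\<^sub>R) c ` R)) =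
      c ^ DIM(real \<times> 'a) * (\<integral>x. (\<phi> x)\<^sup>2 \<partial>lebesgue_on R)"
    using integral_dilation[OF c R, of "\<lambda>x. (\<phi> x)\<^sup>2"] by simp
  have "(\<integral>x. (norm (G (x /\<^sub>R c) /\<^sub>R c))\<^sup>2 \<partial>lebesgue_on ((*\<^sub>R) c ` R)) =
      (\<integral>x. (norm (G (x /\<^sub>R c)))\<^sup>2 / c\<^sup>2 \<partial>lebesgue_on ((*\<^sub>R) c ` R))"
    using c by (simp add: power_mult_distrib divide_inverse power_inverse mult.commute)
  also have "\<dots> = c ^ DIM(real \<times> 'a) * (\<integral>x. (norm (G x))\<^sup>2 \<partial>lebesgue_on R) / c\<^sup>2"
    using integral_dilation[OF c R, of "\<lambda>x. (norm (G x))\<^sup>2 / c\<^sup>2"] by simp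
  finally have quot: "q / c\<^sup>2 = (\<integral>x. (norm (G (x /\<^sub>R c) /\<^sub>R c))\<^sup>2 \<partial>lebesgue_on ((*\<^sub>R) c ` R)) /
      (\<integral>x. (\<phi> (x /\<^sub>R c))\<^sup>2 \<partial>lebesgue_on ((*\<^sub>R) c ` R))"
    using c by (simp add: q_eq int_\<phi>)
  \<comment> \<open>Vanishing almost everywhere is carried back to R through the integral of the
    square, whose scaling is already known.\<close>
  have "\<not> (AE x in lebesgue_on ((*\<^sub>R) c ` R). \<phi> (x /\<^sub>R c) = 0)"
  proof
    assume "AE x in lebesgue_on ((*\<^sub>R) c ` R). \<phi> (x /\<^sub>R c) = 0"
    then have "(\<integral>x. (\<phi> (x /\<^sub>R c))\<^sup>2 \<partial>lebesgue_on ((*\<^sub>R) c ` R)) = 0"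
      by (intro integral_eq_zero_AE) auto
    then have "(\<integral>x. (\<phi> x)\<^sup>2 \<partial>lebesgue_on R) = 0"
      using c by (simp add: int_\<phi>)
    then show False
      using nz integral_nonneg_eq_0_iff_AE[OF int] by simp
  qed
  then show ?thesis
    unfolding rayleigh_quotients_def mem_Collect_eq using quot
      has_H1_gradient_dilation[OF c R H1] has_trace_zero_dilation[OF c R tr]
    by (intro exI[of _ "\<lambda>x. \<phi> (x /\<^sub>R c)"] exI[of _ "\<lambda>x. G (x /\<^sub>R c) /\<^sub>R c"]) simp
qed

text \<open>\<open>rayleigh_quotients_dilation\<close> moves quotients in one direction and so gives
  one inequality between the infima; applying it also to the inverse dilation by 1/c gives the
  other.\<close>

lemma first_eigenvalue_dilation:
  fixes R :: "(real \<times> 'a::euclidean_space) set"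
  assumes c: "c > 0" and R: "R \<in> sets lebesgue" and ne: "rayleigh_quotients R \<noteq> {}"
  shows "first_eigenvalue ((*\<^sub>R) c ` R) = first_eigenvalue R / c\<^sup>2"
proof -
  let ?S = "(*\<^sub>R) c ` R"
  have S: "?S \<in> sets lebesgue"
    using c R by (intro dilation_image_sets_lebesgue) auto
  have R_eq: "(*\<^sub>R) (1 / c) ` ?S = R"
    using c by (simp add: image_image)
  have bdd: "bdd_below (rayleigh_quotients A)" for A :: "(real \<times> 'a) set"
    by (meson bdd_belowI rayleigh_quotients_nonneg)
  have neS: "rayleigh_quotients ?S \<noteq> {}"
    using ne rayleigh_quotients_dilation[OF c R] by blast
  have "first_eigenvalue ?S * c\<^sup>2 \<le> first_eigenvalue R"
    unfolding first_eigenvalue_eq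
  proof (rule cInf_greatest[OF ne])
    fix q assume "q \<in> rayleigh_quotients R"
    then have "Inf (rayleigh_quotients ?S) \<le> q / c\<^sup>2"
      by (intro cInf_lower rayleigh_quotients_dilation c R bdd)
    then show "Inf (rayleigh_quotients ?S) * c\<^sup>2 \<le> q"
      using c by (simp add: field_simps)
  qed
  moreover have "first_eigenvalue R / c\<^sup>2 \<le> first_eigenvalue ?S"
    unfolding first_eigenvalue_eq
  proof (rule cInf_greatest[OF neS])
    fix q assume "q \<in> rayleigh_quotients ?S"
    then have "q / (1 / c)\<^sup>2 \<in> rayleigh_quotients ((*\<^sub>R) (1 / c) ` ?S)"
      by (intro rayleigh_quotients_dilation S) (use c in auto)
    then have "Inf (rayleigh_quotients R) \<le> q / (1 / c)\<^sup>2"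
      unfolding R_eq by (intro cInf_lower bdd)
    then show "Inf (rayleigh_quotients R) / c\<^sup>2 \<le> q"
      using c by (simp add: field_simps)
  qed
  ultimately show ?thesis
    using c by (simp add: field_simps)
qed

section \<open>Smooth functions as members of the form domain\<close>

text \<open>Difference quotients of f in direction b have integral zero by translation invariance,
  and dominated convergence passes this on to the directional derivative. This is the form of
  integration by parts used for smooth functions against test functions.\<close>

lemma integral_derivative_compact_support:
  fixes f :: "'a::euclidean_space \<Rightarrow> real"
  assumes f: "\<And>x. (f has_derivative (\<lambda>h. F x \<bullet> h)) (at x)"
    and F: "continuous_on UNIV F"
    and K: "bounded K" "\<And>x. x \<notin> K \<Longrightarrow> f x = 0"
  shows "(\<integral>x. F x \<bullet> b \<partial>lborel) = 0"
proof -
  obtain r where r: "r > 0" "\<And>x. x \<in> K \<Longrightarrow> norm x \<le> r"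
    using K(1) by (auto simp: bounded_pos)
  define t where "t n = inverse (real (Suc n))" for n
  have t: "0 < t n" "t n \<le> 1" for n
    by (auto simp: t_def field_simps)
  define q where "q n x = (f (t n *\<^sub>R b + x) - f x) / t n" for n x
  have cont: "continuous_on UNIV f"
    using f by (meson continuous_at_imp_continuous_on has_derivative_continuous)
  then have meas[measurable]: "f \<in> borel_measurable borel"
    by (rule borel_measurable_continuous_onI)
  have line: "((\<lambda>s. f (s *\<^sub>R b + x)) has_real_derivative (F (s *\<^sub>R b + x) \<bullet> b)) (at s)" for x s
  proof -
    have "((\<lambda>s. s *\<^sub>R b + x) has_derivative (\<lambda>h. h *\<^sub>R b)) (at s)"
      by (auto intro!: derivative_eq_intros)
    then have "((\<lambda>s. f (s *\<^sub>R b + x)) has_derivative (\<lambda>h. F (s *\<^sub>R b + x) \<bullet> (h *\<^sub>R b))) (at s)"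
      by (rule has_derivative_compose) (rule f)
    then show ?thesis
      by (simp add: has_field_derivative_def mult.commute[of _ "F _ \<bullet> b"] mult_commute_abs)
  qed
  \<comment> \<open>The intermediate point of the mean value theorem is x + s b with 0 < s < 1 and,
    in the relevant case, |x| <= r + |b|. It therefore stays in this larger ball, where F is
    bounded.\<close>
  have "compact (F ` cball 0 (r + 2 * norm b))"
    by (intro compact_continuous_image continuous_on_subset[OF F]) auto
  then obtain B where B: "B > 0" "\<And>x. norm x \<le> r + 2 * norm b \<Longrightarrow> norm (F x) \<le> B"
    by (auto simp: bounded_pos dest!: compact_imp_bounded)
  have int: "integrable lborel f"
  proof -
    have "integrable lborel (\<lambda>x. indicator (cball 0 r) x *\<^sub>R f x)"
      by (intro borel_integrable_compact continuous_on_subset[OF cont]) auto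
    moreover have "indicator (cball 0 r) x *\<^sub>R f x = f x" for x
      using r K by (auto simp: indicator_def)
    ultimately show ?thesis by (simp only:)
  qed
  have shift: "integrable lborel (\<lambda>x. f (c + x))" "(\<integral>x. f (c + x) \<partial>lborel) = (\<integral>x. f x \<partial>lborel)" for c
    using int integrable_distr_eq[of "(+) c" lborel borel f] integral_distr[of "(+) c" lborel borel f]
    by (simp_all add: lborel_distr_plus)
  have "(\<lambda>n. \<integral>x. q n x \<partial>lborel) \<longlonglongrightarrow> (\<integral>x. F x \<bullet> b \<partial>lborel)"
  proof (rule integral_dominated_convergence)
    show "(\<lambda>x. F x \<bullet> b) \<in> borel_measurable lborel"
      using borel_measurable_continuous_onI[OF F] by measurable
    show "q n \<in> borel_measurable lborel" for n
      unfolding q_def by measurable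
    \<comment> \<open>If |x| > r + |b|, then x and x + t b with 0 < t <= 1 both have norm above r
      and so lie outside K; the quotient vanishes there.\<close>
    show "integrable lborel (\<lambda>x. indicator (cball (0::'a) (r + norm b)) x *\<^sub>R (B * norm b))"
      by (intro borel_integrable_compact) auto
    show "AE x in lborel. (\<lambda>n. q n x) \<longlonglongrightarrow> F x \<bullet> b"
    proof (rule AE_I2)
      fix x
      have "((\<lambda>h. (f (h *\<^sub>R b + x) - f x) / h) \<longlongrightarrow> F x \<bullet> b) (at 0)"
        using line[of x 0] by (simp add: DERIV_def)
      moreover have "filterlim t (at 0) sequentially"
        using t(1) LIMSEQ_inverse_real_of_nat unfolding t_def
        by (intro filterlim_atI) (auto simp: less_imp_neq)
      ultimately show "(\<lambda>n. q n x) \<longlonglongrightarrow> F x \<bullet> b"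
        unfolding q_def by (rule filterlim_compose)
    qed
    show "AE x in lborel. norm (q n x) \<le> indicator (cball 0 (r + norm b)) x *\<^sub>R (B * norm b)" for n
    proof (rule AE_I2)
      fix x
      have tb: "norm (s *\<^sub>R b) \<le> norm b" if "0 \<le> s" "s \<le> 1" for s
        using that by (simp add: mult_left_le_one_le)
      show "norm (q n x) \<le> indicator (cball 0 (r + norm b)) x *\<^sub>R (B * norm b)"
      proof (cases "norm x \<le> r + norm b")
        case True
        obtain s where s: "0 < s" "s < t n"
          "f (t n *\<^sub>R b + x) - f (0 *\<^sub>R b + x) = (t n - 0) * (F (s *\<^sub>R b + x) \<bullet> b)"
          using MVT2[OF t(1), where f = "\<lambda>s. f (s *\<^sub>R b + x)"
              and f' = "\<lambda>s. F (s *\<^sub>R b + x) \<bullet> b", OF line] by blast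
        then have "q n x = F (s *\<^sub>R b + x) \<bullet> b"
          using t(1)[of n] by (simp add: q_def)
        moreover have "norm (s *\<^sub>R b + x) \<le> r + 2 * norm b"
          using tb[of s] s t(2)[of n] True norm_triangle_ineq[of "s *\<^sub>R b" x] by linarith
        then have "norm (F (s *\<^sub>R b + x)) * norm b \<le> B * norm b"
          by (intro mult_right_mono B) auto
        ultimately show ?thesis
          using True Cauchy_Schwarz_ineq2[of "F (s *\<^sub>R b + x)" b] by (auto simp: indicator_def)
      next
        case False
        then have "norm (t n *\<^sub>R b + x) > r"
          using tb[of "t n"] t[of n] norm_diff_ineq[of x "t n *\<^sub>R b"] by (simp add: add.commute)
        then have "f (t n *\<^sub>R b + x) = 0"
          using r(2) K(2) by force
        moreover have "norm x > r"
          using False norm_ge_zero[of b] by linarith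
        then have "f x = 0"
          using r(2) K(2) by force
        ultimately show ?thesis
          using False by (auto simp: q_def)
      qed
    qed
  qed
  moreover have "(\<integral>x. q n x \<partial>lborel) = 0" for n
    unfolding q_def using shift int by simp
  ultimately show ?thesis
    by (simp add: LIMSEQ_const_iff)
qed

section \<open>Continuous and smooth functions on bounded sets\<close>

lemma continuous_borel_measurable_lebesgue_on:
  fixes f :: "'a::euclidean_space \<Rightarrow> 'b::euclidean_space"
  assumes "continuous_on UNIV f"
  shows "f \<in> borel_measurable (lebesgue_on R)"
proof -
  have "f \<in> borel_measurable borel"
    using assms by (rule borel_measurable_continuous_onI)
  then have "f \<in> borel_measurable lebesgue"
    by (simp add: measurable_completion)
  then show ?thesis
    by (rule measurable_restrict_space1)
qed

lemma continuous_integrable_bounded: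
  fixes f :: "'a::euclidean_space \<Rightarrow> real"
  assumes "continuous_on UNIV f" "bounded R" "R \<in> sets lebesgue"
  shows "integrable (lebesgue_on R) f"
proof -
  interpret finite_measure "lebesgue_on R"
    using assms by (intro finite_measure_lebesgue_on bounded_set_imp_lmeasurable)
  have "compact (f ` closure R)"
    using assms by (intro compact_continuous_image continuous_on_subset[OF assms(1)]) auto
  then obtain B where "\<forall>x\<in>closure R. norm (f x) \<le> B"
    by (auto simp: bounded_iff dest!: compact_imp_bounded)
  then have B: "norm (f x) \<le> B" if "x \<in> R" for x
    using that closure_subset by blast
  show ?thesis
    by (rule integrable_const_bound[of _ B])
      (use B assms(1) in \<open>auto intro: continuous_borel_measurable_lebesgue_on\<close>)
qed

lemma continuous_square_integrable_bounded:
  fixes f :: "'a::euclidean_space \<Rightarrow> 'b::euclidean_space"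
  assumes "continuous_on UNIV f" "bounded R" "R \<in> sets lebesgue"
  shows "square_integrable (lebesgue_on R) f"
  unfolding square_integrable_def
  using assms by (auto intro!: continuous_borel_measurable_lebesgue_on continuous_integrable_bounded
      continuous_intros)

lemma open_sets_lebesgue: "open R \<Longrightarrow> R \<in> sets lebesgue"
  by (simp add: borel_open sets_completionI_sets)

text \<open>The weak identity says that a partial derivative of Phi psi has integral zero over R.
  Both factors are smooth on the whole space and psi is supported inside R, so this integral equals
  the one over the whole space, where \<open>integral_derivative_compact_support\<close>
  applies.\<close>

lemma smooth_has_H1_gradient:
  fixes \<Phi> :: "'a::euclidean_space \<Rightarrow> real"
  assumes sm: "smooth \<Phi>" and R: "open R" "bounded R"
  shows "has_H1_gradient R \<Phi> (grad \<Phi>)"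
  unfolding has_H1_gradient_def
proof (intro conjI allI impI ballI)
  note RL = open_sets_lebesgue[OF R(1)]
  show "square_integrable (lebesgue_on R) \<Phi>" "square_integrable (lebesgue_on R) (grad \<Phi>)"
    using sm R RL
    by (auto intro!: continuous_square_integrable_bounded smooth_continuous smooth_continuous_grad)
  fix \<psi> and b :: 'a
  assume \<psi>: "test_function R \<psi>"
  define K where "K = closure {x. \<psi> x \<noteq> 0}"
  have sp: "smooth \<psi>" and K: "compact K" "K \<subseteq> R"
    using \<psi> by (auto simp: test_function_def K_def)
  note [continuous_intros] = smooth_continuous[OF sm] smooth_continuous[OF sp]
    smooth_continuous_grad[OF sm] smooth_continuous_grad[OF sp]
  define F where "F x = \<Phi> x *\<^sub>R grad \<psi> x + \<psi> x *\<^sub>R grad \<Phi> x" for x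
  have zero: "\<psi> x = 0" if "x \<notin> K" for x
    using that closure_subset[of "{x. \<psi> x \<noteq> 0}"] by (auto simp: K_def)
  \<comment> \<open>K is closed, so psi is identically zero in a neighbourhood of x.\<close>
  have grad_zero: "grad \<psi> x = 0" if "x \<notin> K" for x
  proof (rule grad_eqI)
    have "((\<lambda>_. 0) has_derivative (\<lambda>h. 0 \<bullet> h)) (at x)"
      by simp
    then show "(\<psi> has_derivative (\<lambda>h. 0 \<bullet> h)) (at x)"
      by (rule has_derivative_transform_within_open[where s = "- K"])
        (use that zero K in \<open>auto simp: compact_imp_closed\<close>)
  qed
  have int1: "integrable (lebesgue_on R) (\<lambda>x. \<Phi> x * (grad \<psi> x \<bullet> b))"
    and int2: "integrable (lebesgue_on R) (\<lambda>x. (grad \<Phi> x \<bullet> b) * \<psi> x)"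
    using R RL by (auto intro!: continuous_integrable_bounded continuous_intros)
  have "(\<integral>x. \<Phi> x * (grad \<psi> x \<bullet> b) \<partial>lebesgue_on R) + (\<integral>x. (grad \<Phi> x \<bullet> b) * \<psi> x \<partial>lebesgue_on R) =
      (\<integral>x. F x \<bullet> b \<partial>lebesgue_on R)"
    unfolding Bochner_Integration.integral_add[OF int1 int2, symmetric]
    by (simp add: F_def inner_add_left mult.commute)
  also have "\<dots> = (\<integral>x. indicator R x *\<^sub>R (F x \<bullet> b) \<partial>lebesgue)"
    using RL by (subst integral_restrict_space) auto
  also have "\<dots> = (\<integral>x. F x \<bullet> b \<partial>lebesgue)"
  proof -
    have "F x = 0" if "x \<notin> R" for x
      using that K zero[of x] grad_zero[of x] unfolding F_def by (metis add_0 scaleR_zero_left scaleR_zero_right subsetD)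
    then show ?thesis
      by (intro Bochner_Integration.integral_cong) (auto simp: indicator_def)
  qed
  also have "\<dots> = (\<integral>x. F x \<bullet> b \<partial>lborel)"
  proof (rule integral_completion)
    have "continuous_on UNIV (\<lambda>x. F x \<bullet> b)"
      unfolding F_def by (intro continuous_intros)
    then show "(\<lambda>x. F x \<bullet> b) \<in> borel_measurable lborel"
      using borel_measurable_continuous_onI by simp
  qed
  also have "\<dots> = 0"
  proof (rule integral_derivative_compact_support[where f = "\<lambda>x. \<Phi> x * \<psi> x" and K = K])
    show "((\<lambda>x. \<Phi> x * \<psi> x) has_derivative (\<lambda>h. F x \<bullet> h)) (at x)" for x
      by (rule has_derivative_eq_rhs, rule has_derivative_mult)
        (auto intro!: smooth_has_derivative sm sp simp: F_def inner_add_left fun_eq_iff)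
    show "continuous_on UNIV F"
      unfolding F_def by (intro continuous_intros)
  qed (use K zero in \<open>auto simp: compact_imp_bounded\<close>)
  finally show "(\<integral>x. \<Phi> x * (grad \<psi> x \<bullet> b) \<partial>lebesgue_on R) =
      - (\<integral>x. (grad \<Phi> x \<bullet> b) * \<psi> x \<partial>lebesgue_on R)"
    by linarith
qed

lemma L2_tendsto_const_self: "(\<And>k x. F k x = f x) \<Longrightarrow> L2_tendsto M F f"
  by (simp add: L2_tendsto_def square_integrable_def)

text \<open>The witness \<open>fst\<close> is positive on R and vanishes on the hyperplane that
  contains \<open>Gamma0\<close>; being smooth, it is its own constant approximating sequence for
  the trace.\<close>

lemma rayleigh_quotients_nonempty:
  fixes R :: "(real \<times> 'a::euclidean_space) set"
  assumes R: "open R" "bounded R" "R \<noteq> {}" and pos: "\<And>p. p \<in> R \<Longrightarrow> fst p > 0"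
  shows "rayleigh_quotients R \<noteq> {}"
proof -
  have sm: "smooth (fst :: real \<times> 'a \<Rightarrow> real)"
    by (intro smooth_bounded_linear bounded_linear_fst)
  note RL = open_sets_lebesgue[OF R(1)]
  have nz: "\<not> (AE p in lebesgue_on R. fst p = 0)"
  proof
    assume "AE p in lebesgue_on R. fst p = 0"
    then have "AE p in lebesgue. p \<in> R \<longrightarrow> fst p = 0"
      using RL by (simp add: AE_restrict_space_iff)
    then have "AE p in lebesgue. p \<notin> R"
      by (rule AE_mp) (use pos in \<open>fastforce intro!: AE_I2\<close>)
    then have "R \<in> null_sets lebesgue"
      using RL by (simp add: AE_iff_null_sets)
    then show False
      using R open_not_negligible by (auto simp: negligible_iff_null_sets)
  qed
  have "has_trace R fst (grad fst) (\<lambda>_. 0)"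
    unfolding has_trace_def using sm by (intro exI[of _ "\<lambda>_. fst"]) (auto intro: L2_tendsto_const_self)
  then show ?thesis
    unfolding rayleigh_quotients_def using nz smooth_has_H1_gradient[OF sm R(1,2)] by blast
qed

section \<open>A weighted inequality on an interval\<close>

text \<open>Integrate the derivative of \<open>M (x - L) w v\<^sup>2\<close>: the decay of \<open>w\<close> produces the term
  \<open>M\<^sup>2 (L - x)\<^sup>2 w v\<^sup>2\<close>, which absorbs the cross term \<open>2 M (x - L) w v v'\<close>.\<close>

lemma weighted_interval_inequality:
  fixes L M :: real
  assumes "L \<ge> 0" "M \<ge> 0"
    and v: "\<And>x. x \<in> {0..L} \<Longrightarrow> (v has_real_derivative v' x) (at x within {0..L})"
    and w: "\<And>x. x \<in> {0..L} \<Longrightarrow> (w has_real_derivative w' x) (at x within {0..L})"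
    and v': "continuous_on {0..L} v'"
    and pos: "\<And>x. x \<in> {0..L} \<Longrightarrow> w x \<ge> 0"
    and decay: "\<And>x. x \<in> {0..L} \<Longrightarrow> w' x \<le> - M * (L - x) * w x"
  shows "M * integral {0..L} (\<lambda>x. w x * (v x)\<^sup>2) \<le>
    M * L * (w 0 * (v 0)\<^sup>2) + integral {0..L} (\<lambda>x. w x * (v' x)\<^sup>2)"
proof -
  define H' where "H' x = M * (w x * (v x)\<^sup>2) + M * (x - L) * (w' x * (v x)\<^sup>2 + w x * (2 * v x * v' x))" for x
  have cv: "continuous_on {0..L} v" and cw: "continuous_on {0..L} w"
    using v w by (meson DERIV_continuous_on)+
  \<comment> \<open>The multiplier vanishes at L, so only the endpoint 0 contributes.\<close>
  have "(H' has_integral (M * (L - L) * (w L * (v L)\<^sup>2) - M * (0 - L) * (w 0 * (v 0)\<^sup>2))) {0..L}"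
    using assms(1)
  proof (intro fundamental_theorem_of_calculus)
    fix x assume x: "x \<in> {0..L}"
    have "((\<lambda>x. M * (x - L) * (w x * (v x)\<^sup>2)) has_real_derivative H' x) (at x within {0..L})"
      by (rule derivative_eq_intros v[OF x] w[OF x] refl)+ (simp add: H'_def algebra_simps)
    then show "((\<lambda>x. M * (x - L) * (w x * (v x)\<^sup>2)) has_vector_derivative H' x) (at x within {0..L})"
      by (simp add: has_real_derivative_iff_has_vector_derivative)
  qed
  then have H: "(H' has_integral M * L * (w 0 * (v 0)\<^sup>2)) {0..L}"
    by simp
  have i1: "(\<lambda>x. w x * (v x)\<^sup>2) integrable_on {0..L}" and i2: "(\<lambda>x. w x * (v' x)\<^sup>2) integrable_on {0..L}"
    by (auto intro!: integrable_continuous_real continuous_intros cv cw v')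
  have "integral {0..L} (\<lambda>x. M * (w x * (v x)\<^sup>2) - w x * (v' x)\<^sup>2) \<le> integral {0..L} H'"
  proof (rule integral_le)
    show "(\<lambda>x. M * (w x * (v x)\<^sup>2) - w x * (v' x)\<^sup>2) integrable_on {0..L}"
      using i1 i2 by (intro integrable_diff integrable_on_mult_right) auto
    show "H' integrable_on {0..L}"
      using H by blast
    fix x assume x: "x \<in> {0..L}"
    \<comment> \<open>In terms of \<open>a\<close> the decay hypothesis reads w' <= - a w, so the
      term - a w' v^2 in H' is at least a^2 w v^2. Expanding w (a v - v')^2 >= 0 shows that the
      cross term costs at most this amount plus w v'^2.\<close>
    define a where "a = M * (L - x)"
    have a: "a \<ge> 0"
      using assms x by (simp add: a_def)
    have "a * w' x \<le> a * (- a * w x)"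
      using decay[OF x] a by (intro mult_left_mono) (auto simp: a_def)
    then have "a * w' x * (v x)\<^sup>2 \<le> - a\<^sup>2 * w x * (v x)\<^sup>2"
      by (intro mult_right_mono) (auto simp: power2_eq_square)
    moreover have "0 \<le> w x * (a * v x - v' x)\<^sup>2"
      using pos[OF x] by simp
    then have "2 * a * w x * v x * v' x \<le> w x * (v' x)\<^sup>2 + a\<^sup>2 * w x * (v x)\<^sup>2"
      by (simp add: power2_eq_square algebra_simps)
    moreover have "M * (x - L) = - a"
      by (simp add: a_def algebra_simps)
    then have "H' x = M * (w x * (v x)\<^sup>2) - a * w' x * (v x)\<^sup>2 - 2 * a * w x * v x * v' x"
      unfolding H'_def by (simp add: ring_distribs)
    ultimately show "M * (w x * (v x)\<^sup>2) - w x * (v' x)\<^sup>2 \<le> H' x"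
      by simp
  qed
  also have "integral {0..L} H' = M * L * (w 0 * (v 0)\<^sup>2)"
    using H by blast
  also have "integral {0..L} (\<lambda>x. M * (w x * (v x)\<^sup>2) - w x * (v' x)\<^sup>2) =
      M * integral {0..L} (\<lambda>x. w x * (v x)\<^sup>2) - integral {0..L} (\<lambda>x. w x * (v' x)\<^sup>2)"
    using i1 i2 by (subst Henstock_Kurzweil_Integration.integral_diff) (auto intro: integrable_on_mult_right)
  finally show ?thesis
    by simp
qed

lemma nn_integral_interval_continuous:
  fixes f :: "real \<Rightarrow> real"
  assumes "continuous_on {a..b} f" "\<And>x. x \<in> {a..b} \<Longrightarrow> 0 \<le> f x"
  shows "(\<integral>\<^sup>+x. ennreal (f x) * indicator {a..b} x \<partial>lborel) = ennreal (integral {a..b} f)"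
  using assms by (intro nn_integral_has_integral_lebesgue' integrable_integral integrable_continuous_real)

section \<open>Integrals over thin domains\<close>

lemma nn_integral_ball_dilation:
  fixes F :: "'a::euclidean_space \<Rightarrow> ennreal"
  assumes c: "c > 0" and [measurable]: "F \<in> borel_measurable borel"
  shows "(\<integral>\<^sup>+y. F y * indicator (ball 0 c) y \<partial>lborel) =
    (\<integral>\<^sup>+z. ennreal (c ^ DIM('a)) * F (c *\<^sub>R z) * indicator (ball 0 1) z \<partial>lborel)"
proof -
  have [measurable]: "ball (0::'a) c \<in> sets borel"
    by simp
  have ind: "indicator (ball 0 c) (c *\<^sub>R z) = (indicator (ball 0 1) z :: ennreal)" for z :: 'a
    using c by (simp add: indicator_def)
  have "(\<integral>\<^sup>+y. F y * indicator (ball 0 c) y \<partial>lborel) =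
      (\<integral>\<^sup>+y. F y * indicator (ball 0 c) y
        \<partial>density (distr lborel borel (\<lambda>z::'a. 0 + c *\<^sub>R z)) (\<lambda>_. ennreal (\<bar>c\<bar> ^ DIM('a))))"
    using c by (subst lborel_affine[of c 0]) auto
  also have "\<dots> = (\<integral>\<^sup>+z. ennreal (c ^ DIM('a)) * (F (c *\<^sub>R z) * indicator (ball 0 1) z) \<partial>lborel)"
    using c by (simp add: nn_integral_density nn_integral_distr ind)
  finally show ?thesis
    by (simp add: mult.assoc)
qed

lemma open_thin_domain:
  assumes "continuous_on UNIV g"
  shows "open (thin_domain L g :: (real \<times> 'a::euclidean_space) set)"
  unfolding thin_domain_def case_prod_beta
  by (intro open_Collect_conj open_Collect_less continuous_intros continuous_on_compose2[OF assms]) auto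

text \<open>The substitution \<open>y = g(x) z\<close> turns the thin domain into a cylinder over the unit ball.\<close>

lemma nn_integral_thin_domain:
  fixes F :: "real \<times> 'a::euclidean_space \<Rightarrow> ennreal"
  assumes g: "continuous_on UNIV g" "\<And>x. g x > 0" and [measurable]: "F \<in> borel_measurable borel"
  shows "(\<integral>\<^sup>+p. F p * indicator (thin_domain L g) p \<partial>lborel) =
    (\<integral>\<^sup>+z. (\<integral>\<^sup>+x. ennreal (g x ^ DIM('a)) * F (x, g x *\<^sub>R z) * indicator {0..L} x \<partial>lborel) *
      indicator (ball 0 1) z \<partial>lborel)"
proof -
  have [measurable]: "g \<in> borel_measurable borel"
    using g(1) by (rule borel_measurable_continuous_onI)
  have [measurable]: "ball (0::'a) 1 \<in> sets borel"
    by simp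
  have F'[measurable]: "F \<in> borel_measurable (borel \<Otimes>\<^sub>M borel)"
    by (simp add: borel_prod)
  have "open (thin_domain L g :: (real \<times> 'a) set)"
    using g(1) by (rule open_thin_domain)
  then have [measurable]: "(thin_domain L g :: (real \<times> 'a) set) \<in> sets (borel \<Otimes>\<^sub>M borel)"
    unfolding borel_prod by (rule borel_open)
  have "(\<integral>\<^sup>+p. F p * indicator (thin_domain L g) p \<partial>lborel) =
      (\<integral>\<^sup>+x. \<integral>\<^sup>+y. F (x, y) * indicator (thin_domain L g) (x, y) \<partial>lborel \<partial>lborel)"
    unfolding lborel_prod[symmetric] by (subst lborel.nn_integral_fst[symmetric]) (auto simp: F')
  also have "\<dots> = (\<integral>\<^sup>+x. \<integral>\<^sup>+z. ennreal (g x ^ DIM('a)) * F (x, g x *\<^sub>R z) * indicator {0..L} x *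
      indicator (ball 0 1) z \<partial>lborel \<partial>lborel)"
  proof (rule nn_integral_cong_AE)
    \<comment> \<open>The domain uses 0 < x < L and the cylinder the closed interval; the two
      endpoints form a null set.\<close>
    have "AE x in lborel. x \<noteq> 0 \<and> x \<noteq> L"
      using AE_lborel_singleton by (auto intro: AE_conjI)
    then show "AE x in lborel. (\<integral>\<^sup>+y. F (x, y) * indicator (thin_domain L g) (x, y) \<partial>lborel) =
        (\<integral>\<^sup>+z. ennreal (g x ^ DIM('a)) * F (x, g x *\<^sub>R z) * indicator {0..L} x *
          indicator (ball 0 1) z \<partial>lborel)"
    proof eventually_elim
      case (elim x)
      have "(\<integral>\<^sup>+y. F (x, y) * indicator (thin_domain L g) (x, y) \<partial>lborel) =
          (\<integral>\<^sup>+y. (F (x, y) * indicator {0..L} x) * indicator (ball 0 (g x)) y \<partial>lborel)"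
        using elim by (intro nn_integral_cong) (auto simp: thin_domain_def indicator_def)
      also have "\<dots> = (\<integral>\<^sup>+z. ennreal (g x ^ DIM('a)) * (F (x, g x *\<^sub>R z) * indicator {0..L} x) *
          indicator (ball 0 1) z \<partial>lborel)"
        by (rule nn_integral_ball_dilation) (auto simp: g)
      finally show ?case
        by (simp add: mult.assoc)
    qed
  qed
  \<comment> \<open>After the swap the inner integral runs along a single curve, with z
    fixed.\<close>
  also have "\<dots> = (\<integral>\<^sup>+z. \<integral>\<^sup>+x. ennreal (g x ^ DIM('a)) * F (x, g x *\<^sub>R z) * indicator {0..L} x *
      indicator (ball 0 1) z \<partial>lborel \<partial>lborel)"
    by (rule lborel_pair.Fubini'[symmetric]) measurable
  also have "\<dots> = (\<integral>\<^sup>+z. (\<integral>\<^sup>+x. ennreal (g x ^ DIM('a)) * F (x, g x *\<^sub>R z) * indicator {0..L} x \<partial>lborel) *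
      indicator (ball 0 1) z \<partial>lborel)"
    by (intro nn_integral_cong nn_integral_multc) measurable
  finally show ?thesis .
qed

text \<open>For fixed z, \<open>weighted_interval_inequality\<close> is applied to w = g^n, the
  Jacobian of the substitution, and to v, the values of Phi along the curve. The factor 2 bounds the
  squared speed 1 + |g' z|^2. With nonnegative extended integrals the inequality can be integrated
  over z without integrability conditions.\<close>

lemma nn_poincare_thin_domain:
  fixes \<Phi> :: "real \<times> 'a::euclidean_space \<Rightarrow> real" and g g' :: "real \<Rightarrow> real"
  assumes sm: "smooth \<Phi>" and L: "L \<ge> 0" and M: "M \<ge> 0"
    and g: "continuous_on UNIV g" "\<And>x. g x > 0"
    and g': "\<And>x. x \<in> {0..L} \<Longrightarrow> (g has_real_derivative g' x) (at x within {0..L})"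
    and cg': "continuous_on {0..L} g'"
    and slope: "\<And>x. x \<in> {0..L} \<Longrightarrow> \<bar>g' x\<bar> \<le> 1"
    and decay: "\<And>x. x \<in> {0..L} \<Longrightarrow> DIM('a) * g' x \<le> - M * (L - x) * g x"
  shows "ennreal M * (\<integral>\<^sup>+p. ennreal ((\<Phi> p)\<^sup>2) * indicator (thin_domain L g) p \<partial>lborel) \<le>
    ennreal (M * L) * (\<integral>\<^sup>+y. ennreal ((\<Phi> (0, y))\<^sup>2) * indicator (ball 0 (g 0)) y \<partial>lborel) +
    2 * (\<integral>\<^sup>+p. ennreal ((norm (grad \<Phi> p))\<^sup>2) * indicator (thin_domain L g) p \<partial>lborel)"
proof -
  let ?n = "DIM('a)"
  note c\<Phi> = smooth_continuous[OF sm] and cG = smooth_continuous_grad[OF sm]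
  have [measurable]: "g \<in> borel_measurable borel" "\<Phi> \<in> borel_measurable borel" "grad \<Phi> \<in> borel_measurable borel"
    using g(1) c\<Phi> cG by (auto intro: borel_measurable_continuous_onI)
  have [measurable]: "\<Phi> \<in> borel_measurable (borel \<Otimes>\<^sub>M borel)" "grad \<Phi> \<in> borel_measurable (borel \<Otimes>\<^sub>M borel)"
    by (simp_all add: borel_prod)
  have [measurable]: "ball (0::'a) 1 \<in> sets borel"
    by simp
  have ray: "ennreal M * (\<integral>\<^sup>+x. ennreal (g x ^ ?n) * ennreal ((\<Phi> (x, g x *\<^sub>R z))\<^sup>2) * indicator {0..L} x \<partial>lborel) \<le>
      ennreal (M * L) * (ennreal (g 0 ^ ?n) * ennreal ((\<Phi> (0, g 0 *\<^sub>R z))\<^sup>2)) +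
      2 * (\<integral>\<^sup>+x. ennreal (g x ^ ?n) * ennreal ((norm (grad \<Phi> (x, g x *\<^sub>R z)))\<^sup>2) * indicator {0..L} x \<partial>lborel)"
    if z: "norm z < 1" for z :: 'a
  proof -
    define w where "w x = g x ^ ?n" for x
    define v where "v x = \<Phi> (x, g x *\<^sub>R z)" for x
    define v' where "v' x = grad \<Phi> (x, g x *\<^sub>R z) \<bullet> (1, g' x *\<^sub>R z)" for x
    define N where "N x = (norm (grad \<Phi> (x, g x *\<^sub>R z)))\<^sup>2" for x
    have cgi: "continuous_on {0..L} g"
      using g(1) by (rule continuous_on_subset) simp
    have cv: "continuous_on {0..L} v"
      unfolding v_def by (intro continuous_on_compose2[OF c\<Phi>] continuous_intros cgi) auto
    have cGv: "continuous_on {0..L} (\<lambda>x. grad \<Phi> (x, g x *\<^sub>R z))"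
      by (intro continuous_on_compose2[OF cG] continuous_intros cgi) auto
    have cv': "continuous_on {0..L} v'"
      unfolding v'_def by (intro continuous_intros cGv cg')
    have cN: "continuous_on {0..L} N"
      unfolding N_def by (intro continuous_intros cGv)
    have cw: "continuous_on {0..L} w"
      unfolding w_def by (intro continuous_intros cgi)
    have pos: "w x \<ge> 0" for x
      using g(2)[of x] by (simp add: w_def)
    have v'_le: "(v' x)\<^sup>2 \<le> 2 * N x" if x: "x \<in> {0..L}" for x
    proof -
      have "\<bar>v' x\<bar> \<le> norm (grad \<Phi> (x, g x *\<^sub>R z)) * norm (1::real, g' x *\<^sub>R z)"
        unfolding v'_def by (rule Cauchy_Schwarz_ineq2)
      then have "(v' x)\<^sup>2 \<le> N x * (norm (1::real, g' x *\<^sub>R z))\<^sup>2"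
        unfolding N_def by (metis abs_ge_zero power2_abs power_mono power_mult_distrib)
      also have "(norm (1::real, g' x *\<^sub>R z))\<^sup>2 = 1 + (\<bar>g' x\<bar> * norm z)\<^sup>2"
        by (simp add: norm_Pair)
      also have "\<bar>g' x\<bar> * norm z \<le> 1"
        using slope[OF x] z by (simp add: mult_le_one)
      then have "N x * (1 + (\<bar>g' x\<bar> * norm z)\<^sup>2) \<le> N x * 2"
        by (intro mult_left_mono) (simp_all add: power_le_one N_def)
      finally show ?thesis
        by simp
    qed
    have "M * integral {0..L} (\<lambda>x. w x * (v x)\<^sup>2) \<le>
        M * L * (w 0 * (v 0)\<^sup>2) + integral {0..L} (\<lambda>x. w x * (v' x)\<^sup>2)"
    proof (rule weighted_interval_inequality[OF L M _ _ cv' pos])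
      fix x assume x: "x \<in> {0..L}"
      have "((\<lambda>x. (x, g x *\<^sub>R z)) has_derivative (\<lambda>h. (h, (g' x * h) *\<^sub>R z))) (at x within {0..L})"
        using g'[OF x] unfolding has_field_derivative_def
        by (auto intro!: derivative_eq_intros)
      then have "(v has_derivative (\<lambda>h. grad \<Phi> (x, g x *\<^sub>R z) \<bullet> (h, (g' x * h) *\<^sub>R z))) (at x within {0..L})"
        unfolding v_def by (rule has_derivative_compose) (rule smooth_has_derivative[OF sm])
      moreover have "(\<lambda>h. grad \<Phi> (x, g x *\<^sub>R z) \<bullet> (h, (g' x * h) *\<^sub>R z)) = (\<lambda>h. v' x * h)"
        by (cases "grad \<Phi> (x, g x *\<^sub>R z)") (auto simp: v'_def fun_eq_iff algebra_simps)
      ultimately show "(v has_real_derivative v' x) (at x within {0..L})"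
        by (simp add: has_field_derivative_def)
      show "(w has_real_derivative real ?n * g x ^ (?n - 1) * g' x) (at x within {0..L})"
        unfolding w_def using g'[OF x] by (auto intro!: derivative_eq_intros)
      \<comment> \<open>Multiplying \<open>decay\<close> by g^(n-1) turns it into decay of w,
        because w' = n g^(n-1) g' and, as n >= 1, g^(n-1) g = w.\<close>
      have "g x ^ (?n - 1) * (?n * g' x) \<le> g x ^ (?n - 1) * (- M * (L - x) * g x)"
        using g(2)[of x] by (intro mult_left_mono decay x) simp
      moreover have "g x ^ (?n - 1) * g x = w x"
        unfolding w_def by (simp add: power_eq_if[of _ ?n] mult.commute)
      ultimately show "real ?n * g x ^ (?n - 1) * g' x \<le> - M * (L - x) * w x"
        by (simp add: algebra_simps)
    qed
    also have "integral {0..L} (\<lambda>x. w x * (v' x)\<^sup>2) \<le> integral {0..L} (\<lambda>x. 2 * (w x * N x))"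
      using pos v'_le
      by (intro integral_le integrable_continuous_real continuous_intros cw cv' cN)
        (simp add: mult.left_commute[of 2] mult_left_mono)
    finally have "M * integral {0..L} (\<lambda>x. w x * (v x)\<^sup>2) \<le>
        M * L * (w 0 * (v 0)\<^sup>2) + 2 * integral {0..L} (\<lambda>x. w x * N x)"
      by simp
    then have "ennreal (M * integral {0..L} (\<lambda>x. w x * (v x)\<^sup>2)) \<le>
        ennreal (M * L * (w 0 * (v 0)\<^sup>2) + 2 * integral {0..L} (\<lambda>x. w x * N x))"
      by (rule ennreal_leI)
    also have "\<dots> = ennreal (M * L) * (ennreal (w 0) * ennreal ((v 0)\<^sup>2)) +
        2 * ennreal (integral {0..L} (\<lambda>x. w x * N x))"
    proof -
      have "0 \<le> integral {0..L} (\<lambda>x. w x * N x)"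
        using pos by (intro Henstock_Kurzweil_Integration.integral_nonneg integrable_continuous_real
            continuous_intros cw cN) (simp add: N_def)
      moreover from this have "ennreal (2 * integral {0..L} (\<lambda>x. w x * N x)) =
          2 * ennreal (integral {0..L} (\<lambda>x. w x * N x))"
        by (subst ennreal_mult) auto
      ultimately show ?thesis
        using L M pos by (simp add: ennreal_mult ennreal_plus)
    qed
    also have "ennreal (M * integral {0..L} (\<lambda>x. w x * (v x)\<^sup>2)) =
        ennreal M * ennreal (integral {0..L} (\<lambda>x. w x * (v x)\<^sup>2))"
      using M by (intro ennreal_mult')
    also have "ennreal (integral {0..L} (\<lambda>x. w x * (v x)\<^sup>2)) =
        (\<integral>\<^sup>+x. ennreal (w x * (v x)\<^sup>2) * indicator {0..L} x \<partial>lborel)"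
      by (rule nn_integral_interval_continuous[symmetric]) (auto intro!: continuous_intros cw cv pos mult_nonneg_nonneg)
    also have "ennreal (integral {0..L} (\<lambda>x. w x * N x)) =
        (\<integral>\<^sup>+x. ennreal (w x * N x) * indicator {0..L} x \<partial>lborel)"
      by (rule nn_integral_interval_continuous[symmetric])
        (auto intro!: continuous_intros cw cGv pos mult_nonneg_nonneg simp: N_def)
    finally show ?thesis
      by (simp add: w_def v_def N_def ennreal_mult g(2) less_imp_le)
  qed
  have "ennreal M * (\<integral>\<^sup>+p. ennreal ((\<Phi> p)\<^sup>2) * indicator (thin_domain L g) p \<partial>lborel) =
      (\<integral>\<^sup>+z. ennreal M * ((\<integral>\<^sup>+x. ennreal (g x ^ ?n) * ennreal ((\<Phi> (x, g x *\<^sub>R z))\<^sup>2) * indicator {0..L} x \<partial>lborel) *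
        indicator (ball 0 1) z) \<partial>lborel)"
    by (subst nn_integral_thin_domain[OF g]) (auto simp: nn_integral_cmult)
  also have "\<dots> \<le> (\<integral>\<^sup>+z. ennreal (M * L) * (ennreal (g 0 ^ ?n) * ennreal ((\<Phi> (0, g 0 *\<^sub>R z))\<^sup>2) * indicator (ball 0 1) z) +
      2 * ((\<integral>\<^sup>+x. ennreal (g x ^ ?n) * ennreal ((norm (grad \<Phi> (x, g x *\<^sub>R z)))\<^sup>2) * indicator {0..L} x \<partial>lborel) *
        indicator (ball 0 1) z) \<partial>lborel)"
    using ray by (intro nn_integral_mono) (auto simp: indicator_def)
  also have "\<dots> = ennreal (M * L) * (\<integral>\<^sup>+z. ennreal (g 0 ^ ?n) * ennreal ((\<Phi> (0, g 0 *\<^sub>R z))\<^sup>2) * indicator (ball 0 1) z \<partial>lborel) +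
      2 * (\<integral>\<^sup>+z. (\<integral>\<^sup>+x. ennreal (g x ^ ?n) * ennreal ((norm (grad \<Phi> (x, g x *\<^sub>R z)))\<^sup>2) * indicator {0..L} x \<partial>lborel) *
        indicator (ball 0 1) z \<partial>lborel)"
    by (subst nn_integral_add) (auto simp: nn_integral_cmult)
  also have "(\<integral>\<^sup>+z. ennreal (g 0 ^ ?n) * ennreal ((\<Phi> (0, g 0 *\<^sub>R z))\<^sup>2) * indicator (ball 0 1) z \<partial>lborel) =
      (\<integral>\<^sup>+y. ennreal ((\<Phi> (0, y))\<^sup>2) * indicator (ball 0 (g 0)) y \<partial>lborel)"
    by (rule nn_integral_ball_dilation[symmetric]) (auto simp: g)
  also have "(\<integral>\<^sup>+z. (\<integral>\<^sup>+x. ennreal (g x ^ ?n) * ennreal ((norm (grad \<Phi> (x, g x *\<^sub>R z)))\<^sup>2) * indicator {0..L} x \<partial>lborel) *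
        indicator (ball 0 1) z \<partial>lborel) =
      (\<integral>\<^sup>+p. ennreal ((norm (grad \<Phi> p))\<^sup>2) * indicator (thin_domain L g) p \<partial>lborel)"
    by (rule nn_integral_thin_domain[OF g, symmetric]) simp
  finally show ?thesis .
qed

section \<open>Lower bounds for Rayleigh quotients\<close>

lemma bounded_thin_domain:
  assumes "continuous_on UNIV g"
  shows "bounded (thin_domain L g :: (real \<times> 'a::euclidean_space) set)"
proof -
  have "compact (g ` {0..L})"
    by (intro compact_continuous_image continuous_on_subset[OF assms]) auto
  then obtain B where B: "\<forall>x\<in>{0..L}. \<bar>g x\<bar> \<le> B"
    by (auto simp: bounded_iff dest!: compact_imp_bounded)
  have "thin_domain L g \<subseteq> {0..L} \<times> (cball 0 B :: 'a set)"
  proof safe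
    fix x and y :: 'a assume "(x, y) \<in> thin_domain L g"
    then have xy: "0 < x" "x < L" "norm y < g x"
      by (auto simp: thin_domain_def)
    then show "x \<in> {0..L}"
      by simp
    with B have "\<bar>g x\<bar> \<le> B"
      by blast
    with xy show "y \<in> cball 0 B"
      by simp
  qed
  then show ?thesis
    by (rule bounded_subset[rotated]) (intro bounded_Times bounded_cball bounded_closed_interval)
qed

text \<open>If |y| < g(0), continuity keeps (s, y) in the domain for small s > 0, so (0, y) is a
  limit of points of the domain but not one of them. The inclusion lets the integral over
  \<open>Gamma0\<close> dominate the boundary term of
  \<open>nn_poincare_thin_domain\<close>.\<close>

lemma ball_subset_Gamma0_thin_domain:
  assumes g: "continuous_on UNIV g" and L: "L > 0"
  shows "ball 0 (g 0) \<subseteq> {y::'a::euclidean_space. (0, y) \<in> Gamma0 (thin_domain L g)}"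
proof safe
  fix y :: 'a assume "y \<in> ball 0 (g 0)"
  then have y: "norm y < g 0"
    by simp
  have "(g \<longlongrightarrow> g 0) (at_right 0)"
    using g by (metis UNIV_I continuous_on_def tendsto_within_subset top_greatest)
  then have "\<forall>\<^sub>F s in at_right 0. norm y < g s"
    using y by (rule order_tendstoD)
  moreover have "\<forall>\<^sub>F s in at_right 0. s \<in> {0<..<L}"
    using L by (rule eventually_at_right_real)
  ultimately have "\<forall>\<^sub>F s in at_right 0. (s, y) \<in> closure (thin_domain L g)"
    by eventually_elim (auto simp: thin_domain_def intro!: subsetD[OF closure_subset])
  moreover have "((\<lambda>s. (s, y)) \<longlongrightarrow> (0, y)) (at_right 0)"
    by (intro tendsto_intros)
  ultimately have "(0, y) \<in> closure (thin_domain L g)"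
    by (intro Lim_in_closed_set[OF closed_closure]) auto
  moreover have "(0, y) \<notin> interior (thin_domain L g)"
    using interior_subset by (fastforce simp: thin_domain_def)
  ultimately show "(0, y) \<in> Gamma0 (thin_domain L g)"
    by (simp add: Gamma0_def frontier_def)
qed

lemma nn_integral_lebesgue_on_eq_integral:
  fixes f :: "'a::euclidean_space \<Rightarrow> real"
  assumes "S \<in> sets lebesgue" "integrable (lebesgue_on S) f" "\<And>x. 0 \<le> f x"
  shows "(\<integral>\<^sup>+x. ennreal (f x) * indicator S x \<partial>lborel) = ennreal (\<integral>x. f x \<partial>lebesgue_on S)"
proof -
  have "ennreal (\<integral>x. f x \<partial>lebesgue_on S) = (\<integral>\<^sup>+x. ennreal (f x) \<partial>lebesgue_on S)"
    using assms by (intro nn_integral_eq_integral[symmetric]) auto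
  also have "\<dots> = (\<integral>\<^sup>+x. ennreal (f x) * indicator S x \<partial>lebesgue)"
    using assms by (intro nn_integral_restrict_space) auto
  finally show ?thesis
    by (simp add: nn_integral_completion)
qed

text \<open>The inequality is moved to Bochner integrals, the ones used in the Rayleigh quotients
  and in \<open>has_trace\<close>. The assumption \<open>trace\<close> guards against the default
  value 0 of the integral over \<open>S\<close>; for the approximants it is part of
  \<open>L2_tendsto\<close>.\<close>

lemma poincare_thin_domain:
  fixes \<Phi> :: "real \<times> 'a::euclidean_space \<Rightarrow> real" and g g' :: "real \<Rightarrow> real" and L :: real
  defines "R \<equiv> thin_domain L g"
  defines "S \<equiv> {y. (0, y) \<in> Gamma0 R}"
  assumes sm: "smooth \<Phi>" and L: "L > 0" and M: "M \<ge> 0"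
    and g: "continuous_on UNIV g" "\<And>x. g x > 0"
    and g': "\<And>x. x \<in> {0..L} \<Longrightarrow> (g has_real_derivative g' x) (at x within {0..L})"
    and cg': "continuous_on {0..L} g'"
    and slope: "\<And>x. x \<in> {0..L} \<Longrightarrow> \<bar>g' x\<bar> \<le> 1"
    and decay: "\<And>x. x \<in> {0..L} \<Longrightarrow> DIM('a) * g' x \<le> - M * (L - x) * g x"
    and trace: "integrable (lebesgue_on S) (\<lambda>y. (\<Phi> (0, y))\<^sup>2)"
  shows "M * (\<integral>p. (\<Phi> p)\<^sup>2 \<partial>lebesgue_on R) \<le>
    M * L * (\<integral>y. (\<Phi> (0, y))\<^sup>2 \<partial>lebesgue_on S) + 2 * (\<integral>p. (norm (grad \<Phi> p))\<^sup>2 \<partial>lebesgue_on R)"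
proof -
  have RL: "R \<in> sets lebesgue"
    unfolding R_def by (intro open_sets_lebesgue open_thin_domain g)
  have SL: "S \<in> sets lebesgue"
    unfolding S_def using closed_Gamma0_slice[of R] by (simp add: borel_closed sets_completionI_sets)
  have bdd: "bounded R"
    unfolding R_def by (intro bounded_thin_domain g)
  have a: "(\<integral>\<^sup>+p. ennreal ((\<Phi> p)\<^sup>2) * indicator R p \<partial>lborel) = ennreal (\<integral>p. (\<Phi> p)\<^sup>2 \<partial>lebesgue_on R)"
    using RL bdd smooth_continuous[OF sm]
    by (intro nn_integral_lebesgue_on_eq_integral continuous_integrable_bounded continuous_intros) auto
  have b: "(\<integral>\<^sup>+p. ennreal ((norm (grad \<Phi> p))\<^sup>2) * indicator R p \<partial>lborel) =
      ennreal (\<integral>p. (norm (grad \<Phi> p))\<^sup>2 \<partial>lebesgue_on R)"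
    using RL bdd smooth_continuous_grad[OF sm]
    by (intro nn_integral_lebesgue_on_eq_integral continuous_integrable_bounded continuous_intros) auto
  have "(\<integral>\<^sup>+y. ennreal ((\<Phi> (0, y))\<^sup>2) * indicator (ball 0 (g 0)) y \<partial>lborel) \<le>
      (\<integral>\<^sup>+y. ennreal ((\<Phi> (0, y))\<^sup>2) * indicator S y \<partial>lborel)"
    unfolding S_def R_def using subsetD[OF ball_subset_Gamma0_thin_domain[OF g(1) L]]
    by (intro nn_integral_mono mult_left_mono) (auto simp: indicator_def simp del: mem_ball)
  also have "\<dots> = ennreal (\<integral>y. (\<Phi> (0, y))\<^sup>2 \<partial>lebesgue_on S)"
    using SL trace by (intro nn_integral_lebesgue_on_eq_integral) auto
  finally have t: "(\<integral>\<^sup>+y. ennreal ((\<Phi> (0, y))\<^sup>2) * indicator (ball 0 (g 0)) y \<partial>lborel) \<le>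
      ennreal (\<integral>y. (\<Phi> (0, y))\<^sup>2 \<partial>lebesgue_on S)" .
  have "ennreal (M * (\<integral>p. (\<Phi> p)\<^sup>2 \<partial>lebesgue_on R)) \<le>
      ennreal (M * L) * (\<integral>\<^sup>+y. ennreal ((\<Phi> (0, y))\<^sup>2) * indicator (ball 0 (g 0)) y \<partial>lborel) +
      2 * ennreal (\<integral>p. (norm (grad \<Phi> p))\<^sup>2 \<partial>lebesgue_on R)"
    using nn_poincare_thin_domain[OF sm less_imp_le[OF L] M g g' cg' slope decay] M
    unfolding R_def[symmetric] a b by (simp add: ennreal_mult)
  also have "\<dots> \<le> ennreal (M * L) * ennreal (\<integral>y. (\<Phi> (0, y))\<^sup>2 \<partial>lebesgue_on S) +
      2 * ennreal (\<integral>p. (norm (grad \<Phi> p))\<^sup>2 \<partial>lebesgue_on R)"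
    by (intro add_right_mono mult_left_mono t) simp
  also have "\<dots> = ennreal (M * L * (\<integral>y. (\<Phi> (0, y))\<^sup>2 \<partial>lebesgue_on S) +
      2 * (\<integral>p. (norm (grad \<Phi> p))\<^sup>2 \<partial>lebesgue_on R))"
    using L M by (simp add: ennreal_mult ennreal_plus)
  finally show ?thesis
    by (rule ennreal_le_iff[THEN iffD1, rotated]) (use L M in simp)
qed

text \<open>Combines the triangle inequality with 2 p q <= p^2 + q^2. It is applied twice, to bound
  phi by an approximant and the gradient of the approximant by G, at the cost of a factor 2 each
  time.\<close>

lemma integral_norm_square_le:
  fixes u v :: "'a \<Rightarrow> 'b::euclidean_space"
  assumes u: "square_integrable M u" and uv: "square_integrable M (\<lambda>x. v x - u x)"
  shows "(\<integral>x. (norm (v x))\<^sup>2 \<partial>M) \<le> 2 * (\<integral>x. (norm (u x))\<^sup>2 \<partial>M) + 2 * (\<integral>x. (norm (v x - u x))\<^sup>2 \<partial>M)"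
proof -
  have "(\<integral>x. (norm (v x))\<^sup>2 \<partial>M) \<le> (\<integral>x. 2 * (norm (u x))\<^sup>2 + 2 * (norm (v x - u x))\<^sup>2 \<partial>M)"
  proof (rule integral_mono')
    show "integrable M (\<lambda>x. 2 * (norm (u x))\<^sup>2 + 2 * (norm (v x - u x))\<^sup>2)"
      using u uv by (auto simp: square_integrable_def)
    fix x
    have "(norm (v x))\<^sup>2 \<le> (norm (u x) + norm (v x - u x))\<^sup>2"
      using norm_triangle_sub[of "v x" "u x"] by (intro power_mono) auto
    also have "\<dots> \<le> 2 * (norm (u x))\<^sup>2 + 2 * (norm (v x - u x))\<^sup>2"
      using sum_squares_bound[of "norm (u x)" "norm (v x - u x)"] by (simp add: power2_sum)
    finally show "(norm (v x))\<^sup>2 \<le> 2 * (norm (u x))\<^sup>2 + 2 * (norm (v x - u x))\<^sup>2" .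
  qed simp
  also have "\<dots> = 2 * (\<integral>x. (norm (u x))\<^sup>2 \<partial>M) + 2 * (\<integral>x. (norm (v x - u x))\<^sup>2 \<partial>M)"
    using u uv by (subst Bochner_Integration.integral_add) (auto simp: square_integrable_def)
  finally show ?thesis .
qed

lemma square_integrable_minus_commute:
  "square_integrable M (\<lambda>x. u x - v x) \<Longrightarrow> square_integrable M (\<lambda>x. v x - u x)"
  using square_integrable_scaleR[of M "\<lambda>x. u x - v x" "-1"] by simp

text \<open>The Poincare inequality is applied to the smooth approximants, and the trace term and
  both approximation errors disappear in the limit. One factor 2 comes from
  \<open>poincare_thin_domain\<close>, the other two from \<open>integral_norm_square_le\<close>;
  together they give 8.\<close>

lemma rayleigh_quotients_thin_domain_ge:
  fixes g g' :: "real \<Rightarrow> real" and L :: real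
  defines "R \<equiv> (thin_domain L g :: (real \<times> 'a::euclidean_space) set)"
  assumes L: "L > 0" and M: "M \<ge> 0"
    and g: "continuous_on UNIV g" "\<And>x. g x > 0"
    and g': "\<And>x. x \<in> {0..L} \<Longrightarrow> (g has_real_derivative g' x) (at x within {0..L})"
    and cg': "continuous_on {0..L} g'"
    and slope: "\<And>x. x \<in> {0..L} \<Longrightarrow> \<bar>g' x\<bar> \<le> 1"
    and decay: "\<And>x. x \<in> {0..L} \<Longrightarrow> DIM('a) * g' x \<le> - M * (L - x) * g x"
    and q: "q \<in> rayleigh_quotients R"
  shows "M / 8 \<le> q"
proof -
  define S where "S = {y. (0, y) \<in> Gamma0 R}"
  obtain \<phi> G where q_eq: "q = (\<integral>x. (norm (G x))\<^sup>2 \<partial>lebesgue_on R) / (\<integral>x. (\<phi> x)\<^sup>2 \<partial>lebesgue_on R)"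
    and H1: "has_H1_gradient R \<phi> G" and nz: "\<not> (AE x in lebesgue_on R. \<phi> x = 0)"
    and tr: "has_trace R \<phi> G (\<lambda>_. 0)"
    using q by (auto simp: rayleigh_quotients_def)
  have sq: "square_integrable (lebesgue_on R) \<phi>" "square_integrable (lebesgue_on R) G"
    using H1 by (auto simp: has_H1_gradient_def)
  obtain \<Phi> where sm: "\<And>k. smooth (\<Phi> k)" and \<Phi>: "L2_tendsto (lebesgue_on R) \<Phi> \<phi>"
    and G: "L2_tendsto (lebesgue_on R) (\<lambda>k. grad (\<Phi> k)) G"
    and t: "L2_tendsto (lebesgue_on S) (\<lambda>k y. \<Phi> k (0, y)) (\<lambda>_. 0)"
    using tr by (auto simp: has_trace_def S_def)
  define d where "d k = (\<integral>x. (\<Phi> k x - \<phi> x)\<^sup>2 \<partial>lebesgue_on R)" for k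
  define e where "e k = (\<integral>x. (norm (grad (\<Phi> k) x - G x))\<^sup>2 \<partial>lebesgue_on R)" for k
  define s where "s k = (\<integral>y. (\<Phi> k (0, y))\<^sup>2 \<partial>lebesgue_on S)" for k
  define a where "a = (\<integral>x. (\<phi> x)\<^sup>2 \<partial>lebesgue_on R)"
  define b where "b = (\<integral>x. (norm (G x))\<^sup>2 \<partial>lebesgue_on R)"
  have lims: "d \<longlonglongrightarrow> 0" "e \<longlonglongrightarrow> 0" "s \<longlonglongrightarrow> 0"
    using \<Phi> G t unfolding L2_tendsto_def d_def[abs_def] e_def[abs_def] s_def[abs_def] by simp_all
  have "integrable (lebesgue_on R) (\<lambda>x. (\<phi> x)\<^sup>2)"
    using sq by (simp add: square_integrable_def)
  then have "a \<noteq> 0"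
    unfolding a_def using nz by (simp add: integral_nonneg_eq_0_iff_AE)
  moreover have "a \<ge> 0"
    unfolding a_def by simp
  ultimately have a: "a > 0"
    by simp
  have bound: "M * a \<le> 8 * b + (2 * M * L * s k + 8 * e k + 2 * M * d k)" for k
  proof -
    have RB: "open R" "bounded R"
      unfolding R_def using g by (auto intro: open_thin_domain bounded_thin_domain)
    note RL = open_sets_lebesgue[OF RB(1)]
    have "square_integrable (lebesgue_on R) (\<Phi> k)"
      using RB RL by (intro continuous_square_integrable_bounded smooth_continuous sm)
    then have "a \<le> 2 * (\<integral>x. (\<Phi> k x)\<^sup>2 \<partial>lebesgue_on R) + 2 * d k"
      using integral_norm_square_le[of "lebesgue_on R" "\<Phi> k" \<phi>]
        square_integrable_minus_commute[of "lebesgue_on R" "\<Phi> k" \<phi>] \<Phi>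
      by (simp add: a_def d_def L2_tendsto_def power2_commute)
    then have "M * a \<le> M * (2 * (\<integral>x. (\<Phi> k x)\<^sup>2 \<partial>lebesgue_on R) + 2 * d k)"
      using M by (rule mult_left_mono)
    moreover have "(\<integral>x. (norm (grad (\<Phi> k) x))\<^sup>2 \<partial>lebesgue_on R) \<le> 2 * b + 2 * e k"
      unfolding b_def e_def using sq(2) G by (intro integral_norm_square_le) (auto simp: L2_tendsto_def)
    moreover have "M * (\<integral>x. (\<Phi> k x)\<^sup>2 \<partial>lebesgue_on R) \<le>
        M * L * s k + 2 * (\<integral>x. (norm (grad (\<Phi> k) x))\<^sup>2 \<partial>lebesgue_on R)"
      unfolding s_def S_def R_def
    proof (rule poincare_thin_domain[OF sm L M g g' cg' slope decay])
      show "integrable (lebesgue_on {y. (0, y) \<in> Gamma0 (thin_domain L g)}) (\<lambda>y. (\<Phi> k (0, y))\<^sup>2)"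
        using t by (simp add: L2_tendsto_def square_integrable_def S_def R_def)
    qed
    ultimately show ?thesis
      by (simp add: algebra_simps)
  qed
  have "(\<lambda>k. 8 * b + (2 * M * L * s k + 8 * e k + 2 * M * d k)) \<longlonglongrightarrow>
      8 * b + (2 * M * L * 0 + 8 * 0 + 2 * M * 0)"
    by (intro tendsto_intros lims)
  then have "M * a \<le> 8 * b"
    using bound by (intro LIMSEQ_le_const) auto
  then show ?thesis
    using a by (simp add: q_eq a_def[symmetric] b_def[symmetric] field_simps)
qed

section \<open>The eigenvalue asymptotics\<close>

lemma thin_domain_cong:
  "(\<And>x. x \<in> {0<..<L} \<Longrightarrow> g x = h x) \<Longrightarrow> thin_domain L g = thin_domain L h"
  by (auto simp: thin_domain_def)

lemma thin_domain_dilation: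
  assumes "c > 0"
  shows "(*\<^sub>R) c ` thin_domain L g = thin_domain (c * L) (\<lambda>x. c * g (x / c))"
proof (intro set_eqI iffI)
  fix p assume "p \<in> (*\<^sub>R) c ` thin_domain L g"
  then show "p \<in> thin_domain (c * L) (\<lambda>x. c * g (x / c))"
    using assms by (auto simp: thin_domain_def)
next
  fix p assume "p \<in> thin_domain (c * L) (\<lambda>x. c * g (x / c))"
  then have "p /\<^sub>R c \<in> thin_domain L g"
    using assms by (auto simp: thin_domain_def field_simps zero_less_mult_iff)
  then show "p \<in> (*\<^sub>R) c ` thin_domain L g"
    using assms by (intro image_eqI[of _ _ "p /\<^sub>R c"]) auto
qed

text \<open>Weights are only prescribed on \<open>[0, L]\<close>; composing with \<open>clip L\<close> extends them
  continuously to the whole line without changing the thin domain.\<close>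

definition clip :: "real \<Rightarrow> real \<Rightarrow> real" where
  "clip L x = max 0 (min x L)"

lemma clip_in_interval: "L \<ge> 0 \<Longrightarrow> clip L x \<in> {0..L}"
  by (auto simp: clip_def)

lemma clip_id: "x \<in> {0..L} \<Longrightarrow> clip L x = x"
  by (auto simp: clip_def)

lemma continuous_on_clip:
  assumes "continuous_on {0..L} f" "L \<ge> 0"
  shows "continuous_on UNIV (\<lambda>x. f (clip L x))"
  using clip_in_interval[OF assms(2)] unfolding clip_def
  by (intro continuous_on_compose2[OF assms(1)] continuous_intros) auto

text \<open>The function f - c x is nondecreasing, so its value at x is at most its value at L. With
  f = gamma' and c = alpha2 this is the quantitative form of convexity that drives the
  decay.\<close>

lemma convex_derivative_le:
  fixes L :: real
  assumes f: "\<And>x. x \<in> {0..L} \<Longrightarrow> (f has_real_derivative f' x) (at x within {0..L})"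
    and f': "\<And>x. x \<in> {0..L} \<Longrightarrow> c \<le> f' x" and fL: "f L \<le> 0" and x: "x \<in> {0..L}"
  shows "f x \<le> - c * (L - x)"
proof (cases "x = L")
  case False
  with x have "x \<le> L"
    by simp
  then have "f x - c * x \<le> f L - c * L"
  proof (rule DERIV_nonneg_imp_increasing_open[where f = "\<lambda>x. f x - c * x"])
    fix y assume y: "x < y" "y < L"
    then have "(f has_real_derivative f' y) (at y)"
      using f[of y] x by (simp add: at_within_Icc_at)
    then have "((\<lambda>x. f x - c * x) has_real_derivative f' y - c) (at y)"
      by (auto intro!: derivative_eq_intros)
    moreover have "f' y - c \<ge> 0"
      using f'[of y] x y by simp
    ultimately show "\<exists>z. ((\<lambda>x. f x - c * x) has_real_derivative z) (at y) \<and> z \<ge> 0"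
      by blast
  next
    have "continuous_on {0..L} f"
      using f by (rule DERIV_continuous_on)
    then have "continuous_on {x..L} f"
      by (rule continuous_on_subset) (use x in auto)
    then show "continuous_on {x..L} (\<lambda>x. f x - c * x)"
      by (intro continuous_intros)
  qed
  then show ?thesis
    using fL by (simp add: algebra_simps)
qed (use fL in simp)

theorem mainTheorem2:
  fixes L \<alpha>0 \<alpha>1 \<alpha>2 :: real
    and \<gamma> \<gamma>' \<gamma>'' :: "real \<Rightarrow> real"
    and g :: "real \<Rightarrow> real \<Rightarrow> real"
    and R :: "real \<Rightarrow> (real \<times> (real ^ 'n)) set"
    and \<tau> :: "real \<Rightarrow> real"
  assumes "L > 0"
    and "\<And>x. x \<in> {0..L} \<Longrightarrow> (\<gamma> has_real_derivative \<gamma>' x) (at x within {0..L})"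
    and "\<And>x. x \<in> {0..L} \<Longrightarrow> (\<gamma>' has_real_derivative \<gamma>'' x) (at x within {0..L})"
    and "continuous_on {0..L} \<gamma>''"
    and "\<alpha>0 > 0" and "\<alpha>1 > 0" and "\<alpha>1 < 1" and "\<alpha>2 > 0"
    and "\<And>x. x \<in> {0..L} \<Longrightarrow> \<alpha>0 \<le> \<gamma> x \<and> \<gamma> x \<le> \<alpha>1"
    and "\<gamma>' L \<le> 0"
    and "\<And>x. x \<in> {0..L} \<Longrightarrow> \<gamma>'' x \<ge> \<alpha>2"
    and g: "g = (\<lambda>\<epsilon> x. \<gamma> x powr (1 / \<epsilon>))"
    and R: "R = (\<lambda>\<epsilon>. thin_domain L (g \<epsilon>))"
    and \<tau>: "\<tau> = (\<lambda>\<epsilon>. first_eigenvalue (R \<epsilon>))"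
  shows "(\<exists>\<rho>. admissible_scaling \<alpha>1 \<tau> \<rho>) \<and>
    (\<forall>\<rho> R' \<tau>'. admissible_scaling \<alpha>1 \<tau> \<rho> \<longrightarrow>
       R' = (\<lambda>\<epsilon>. (\<lambda>x. \<rho> \<epsilon> *\<^sub>R x) ` R \<epsilon>) \<longrightarrow>
       \<tau>' = (\<lambda>\<epsilon>. first_eigenvalue (R' \<epsilon>)) \<longrightarrow>
       (\<forall>\<epsilon>>0. R' \<epsilon> = thin_domain (\<rho> \<epsilon> * L) (\<lambda>x1. \<rho> \<epsilon> * g \<epsilon> (x1 / \<rho> \<epsilon>))) \<and>
       filterlim (\<lambda>\<epsilon>. \<rho> \<epsilon> * L) at_top (at_right 0) \<and>
       (\<forall>\<epsilon>>0. \<forall>x1\<in>{0<..<\<rho> \<epsilon> * L}.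
          0 < \<rho> \<epsilon> * g \<epsilon> (x1 / \<rho> \<epsilon>) \<and>
          \<rho> \<epsilon> * g \<epsilon> (x1 / \<rho> \<epsilon>) \<le> \<alpha>1 powr (1 / \<epsilon>) * \<rho> \<epsilon>) \<and>
       ((\<lambda>\<epsilon>. \<alpha>1 powr (1 / \<epsilon>) * \<rho> \<epsilon>) \<longlongrightarrow> 0) (at_right 0) \<and>
       (\<forall>\<delta>>0. \<forall>\<^sub>F \<epsilon> in at_right 0. \<forall>x1\<in>{0<..<\<rho> \<epsilon> * L}. \<bar>\<rho> \<epsilon> * g \<epsilon> (x1 / \<rho> \<epsilon>)\<bar> < \<delta>) \<and>
       (\<forall>\<epsilon>>0. \<tau>' \<epsilon> = \<tau> \<epsilon> / (\<rho> \<epsilon>)\<^sup>2) \<and>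
       filterlim \<tau>' at_top (at_right 0))"
proof -
  note [simp] = \<open>L > 0\<close> less_imp_le[OF \<open>L > 0\<close>]
  define n where "n = DIM(real ^ 'n)"
  have n: "n > 0"
    unfolding n_def by (rule DIM_positive)
  \<comment> \<open>\<open>ge\<close> agrees with \<open>g\<close> on [0, L] and is continuous on
    the whole line, as the lemmas on thin domains require; \<open>ge'\<close> is the derivative of
    gamma^(1/eps) on [0, L].\<close>
  define ge where "ge \<epsilon> x = g \<epsilon> (clip L x)" for \<epsilon> x
  define ge' where "ge' \<epsilon> x = \<gamma> x powr (1 / \<epsilon>) * (\<gamma>' x / (\<epsilon> * \<gamma> x))" for \<epsilon> x
  have \<gamma>_pos: "\<gamma> x > 0" if "x \<in> {0..L}" for x
    using assms(5,9) that by fastforce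
  have c\<gamma>: "continuous_on {0..L} \<gamma>" and c\<gamma>': "continuous_on {0..L} \<gamma>'"
    using assms(2,3) by (meson DERIV_continuous_on)+
  have g_le: "0 < g \<epsilon> x" "g \<epsilon> x \<le> \<alpha>1 powr (1 / \<epsilon>)" if "\<epsilon> > 0" "x \<in> {0..L}" for \<epsilon> x
    using that \<gamma>_pos[of x] assms(9)[of x] by (auto simp: g intro!: powr_mono2)
  have ge_pos: "ge \<epsilon> x > 0" if "\<epsilon> > 0" for \<epsilon> x
    unfolding ge_def using that by (intro g_le clip_in_interval) simp_all
  have cge: "continuous_on UNIV (ge \<epsilon>)" for \<epsilon>
    unfolding ge_def g using \<gamma>_pos
    by (intro continuous_on_clip continuous_intros c\<gamma>) (auto simp: less_le)
  have R_eq: "R \<epsilon> = thin_domain L (ge \<epsilon>)" for \<epsilon>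
    unfolding R by (rule thin_domain_cong) (simp add: ge_def clip_id)
  have Ropen: "open (R \<epsilon>)" and Rbdd: "bounded (R \<epsilon>)" for \<epsilon>
    unfolding R_eq by (intro open_thin_domain bounded_thin_domain cge)+
  have ne: "rayleigh_quotients (R \<epsilon>) \<noteq> {}" if "\<epsilon> > 0" for \<epsilon>
  proof (rule rayleigh_quotients_nonempty[OF Ropen Rbdd])
    have "(L / 2, 0) \<in> R \<epsilon>"
      unfolding R_eq using ge_pos[OF that] by (simp add: thin_domain_def)
    then show "R \<epsilon> \<noteq> {}"
      by blast
  qed (auto simp: R thin_domain_def)
  \<comment> \<open>Together with gamma >= alpha0 this yields |g_eps'| <= alpha1^(1/eps) K / (eps
    alpha0), the quantity that the hypothesis \<open>small\<close> below keeps under 1.\<close>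
  obtain K where K: "\<And>x. x \<in> {0..L} \<Longrightarrow> \<bar>\<gamma>' x\<bar> \<le> K" "K \<ge> 0"
  proof -
    have "compact (\<gamma>' ` {0..L})"
      by (intro compact_continuous_image c\<gamma>') auto
    then obtain B where "\<forall>x\<in>{0..L}. \<bar>\<gamma>' x\<bar> \<le> B"
      by (auto simp: bounded_iff dest!: compact_imp_bounded)
    then show ?thesis
      by (intro that[of "max B 0"]) (auto simp: le_max_iff_disj)
  qed
  \<comment> \<open>Chosen so that c / eps = M / 8 for M = n alpha2 / (eps alpha1).\<close>
  define c where "c = n * \<alpha>2 / (8 * \<alpha>1)"
  have c: "c > 0"
    using n assms by (simp add: c_def)
  have \<tau>_ge: "c / \<epsilon> \<le> \<tau> \<epsilon>" if \<epsilon>: "\<epsilon> > 0" and small: "\<alpha>1 powr (1 / \<epsilon>) * (K / (\<epsilon> * \<alpha>0)) \<le> 1" for \<epsilon>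
  proof -
    define M where "M = n * \<alpha>2 / (\<epsilon> * \<alpha>1)"
    have M: "M \<ge> 0"
      using \<epsilon> assms by (simp add: M_def)
    have ge_eq: "ge \<epsilon> x = \<gamma> x powr (1 / \<epsilon>)" if "x \<in> {0..L}" for x
      using that by (simp add: ge_def g clip_id)
    have "M / 8 \<le> q" if "q \<in> rayleigh_quotients (R \<epsilon>)" for q
    proof (rule rayleigh_quotients_thin_domain_ge[OF \<open>L > 0\<close> M cge ge_pos[OF \<epsilon>] _ _ _ _ that[unfolded R_eq]])
      fix x assume x: "x \<in> {0..L}"
      have "((\<lambda>x. \<gamma> x powr (1 / \<epsilon>)) has_real_derivative ge' \<epsilon> x) (at x within {0..L})"
        unfolding has_field_derivative_def
        by (rule has_derivative_eq_rhs,
            rule has_derivative_powr[OF assms(2)[OF x, unfolded has_field_derivative_def]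
              has_derivative_const \<gamma>_pos[OF x] x])
          (use \<epsilon> in \<open>auto simp: ge'_def fun_eq_iff\<close>)
      then show "(ge \<epsilon> has_real_derivative ge' \<epsilon> x) (at x within {0..L})"
        unfolding has_field_derivative_def
        by (rule has_derivative_transform[rotated 2]) (use x in \<open>auto simp: ge_eq\<close>)
      have powr_le: "\<gamma> x powr (1 / \<epsilon>) \<le> \<alpha>1 powr (1 / \<epsilon>)"
        using g_le(2)[OF \<epsilon> x] by (simp add: g)
      have "\<bar>\<gamma>' x / (\<epsilon> * \<gamma> x)\<bar> \<le> K / (\<epsilon> * \<alpha>0)"
        unfolding abs_divide using K(1)[OF x] assms(5) assms(9)[OF x] \<epsilon> by (intro frac_le) auto
      then have "\<bar>ge' \<epsilon> x\<bar> \<le> \<alpha>1 powr (1 / \<epsilon>) * (K / (\<epsilon> * \<alpha>0))"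
        unfolding ge'_def abs_mult using powr_le by (intro mult_mono) auto
      with small show "\<bar>ge' \<epsilon> x\<bar> \<le> 1"
        by simp
      have "\<gamma>' x \<le> - \<alpha>2 * (L - x)"
        by (rule convex_derivative_le[OF assms(3,11,10) x])
      moreover have "0 \<le> \<alpha>2 * (L - x)"
        using assms(8) x by simp
      then have "\<gamma>' x \<le> 0"
        using calculation by linarith
      \<comment> \<open>The numerator is nonnegative, so the denominator gamma may be replaced by
        its upper bound alpha1; this is how alpha1 enters M.\<close>
      ultimately have "\<alpha>2 * (L - x) / \<alpha>1 \<le> - \<gamma>' x / \<gamma> x"
        using x \<gamma>_pos[OF x] assms(8) assms(9)[OF x]
        by (intro frac_le) auto
      then have "n * (\<alpha>2 * (L - x) / \<alpha>1) * (\<gamma> x powr (1 / \<epsilon>) / \<epsilon>) \<le>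
          n * (- \<gamma>' x / \<gamma> x) * (\<gamma> x powr (1 / \<epsilon>) / \<epsilon>)"
        using \<epsilon> by (intro mult_right_mono mult_left_mono) auto
      then show "DIM(real ^ 'n) * ge' \<epsilon> x \<le> - M * (L - x) * ge \<epsilon> x"
        using x by (simp add: ge_eq ge'_def M_def n_def mult_ac)
    next
      show "continuous_on {0..L} (ge' \<epsilon>)"
        unfolding ge'_def using \<gamma>_pos \<epsilon>
        by (intro continuous_intros c\<gamma> c\<gamma>') (auto simp: less_le)
    qed
    then have "M / 8 \<le> \<tau> \<epsilon>"
      unfolding \<tau> first_eigenvalue_eq by (intro cInf_greatest ne[OF \<epsilon>])
    then show ?thesis
      by (simp add: M_def c_def mult_ac)
  qed
  \<comment> \<open>Since alpha1 < 1, the exponential decay of alpha1^(1/eps) beats 1/eps, so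
    \<open>small\<close> holds for all sufficiently small eps > 0.\<close>
  have "((\<lambda>\<epsilon>. \<alpha>1 powr (1 / \<epsilon>) * (K / (\<epsilon> * \<alpha>0))) \<longlongrightarrow> 0) (at_right 0)"
    using assms(5,6,7) by real_asymp
  then have "\<forall>\<^sub>F \<epsilon> in at_right 0. \<alpha>1 powr (1 / \<epsilon>) * (K / (\<epsilon> * \<alpha>0)) < 1"
    by (rule order_tendstoD) simp
  then have ev: "\<forall>\<^sub>F \<epsilon> in at_right 0. c / \<epsilon> \<le> \<tau> \<epsilon>"
    using eventually_at_right_less[of 0] by eventually_elim (auto intro: \<tau>_ge)
  \<comment> \<open>Any exponent strictly between -1/2 and 0 would do: rho^2 must grow more slowly
    than 1/eps, while alpha1^(1/eps) outweighs every power. For -1/4 the quotient tau / rho^2 is at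
    least c eps^(-1/2) for small eps.\<close>
  have "admissible_scaling \<alpha>1 \<tau> (\<lambda>\<epsilon>. \<epsilon> powr (- 1 / 4))"
    unfolding admissible_scaling_def
  proof (intro conjI allI impI)
    show "filterlim (\<lambda>\<epsilon>::real. \<epsilon> powr (- 1 / 4)) at_top (at_right 0)"
      by real_asymp
    show "((\<lambda>\<epsilon>. \<alpha>1 powr (1 / \<epsilon>) * \<epsilon> powr (- 1 / 4)) \<longlongrightarrow> 0) (at_right 0)"
      using assms(6,7) by real_asymp
    have "filterlim (\<lambda>\<epsilon>. c / \<epsilon> / (\<epsilon> powr (- 1 / 4))\<^sup>2) at_top (at_right 0)"
      using c by real_asymp
    then show "filterlim (\<lambda>\<epsilon>. \<tau> \<epsilon> / (\<epsilon> powr (- 1 / 4))\<^sup>2) at_top (at_right 0)"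
    proof (rule filterlim_at_top_mono)
      show "\<forall>\<^sub>F \<epsilon> in at_right 0.
          c / \<epsilon> / (\<epsilon> powr (- 1 / 4))\<^sup>2 \<le> \<tau> \<epsilon> / (\<epsilon> powr (- 1 / 4))\<^sup>2"
        using ev by eventually_elim (rule divide_right_mono, simp_all)
    qed
  qed simp
  moreover have "(\<forall>\<epsilon>>0. R' \<epsilon> = thin_domain (\<rho> \<epsilon> * L) (\<lambda>x1. \<rho> \<epsilon> * g \<epsilon> (x1 / \<rho> \<epsilon>))) \<and>
       filterlim (\<lambda>\<epsilon>. \<rho> \<epsilon> * L) at_top (at_right 0) \<and>
       (\<forall>\<epsilon>>0. \<forall>x1\<in>{0<..<\<rho> \<epsilon> * L}.
          0 < \<rho> \<epsilon> * g \<epsilon> (x1 / \<rho> \<epsilon>) \<and>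
          \<rho> \<epsilon> * g \<epsilon> (x1 / \<rho> \<epsilon>) \<le> \<alpha>1 powr (1 / \<epsilon>) * \<rho> \<epsilon>) \<and>
       ((\<lambda>\<epsilon>. \<alpha>1 powr (1 / \<epsilon>) * \<rho> \<epsilon>) \<longlongrightarrow> 0) (at_right 0) \<and>
       (\<forall>\<delta>>0. \<forall>\<^sub>F \<epsilon> in at_right 0. \<forall>x1\<in>{0<..<\<rho> \<epsilon> * L}. \<bar>\<rho> \<epsilon> * g \<epsilon> (x1 / \<rho> \<epsilon>)\<bar> < \<delta>) \<and>
       (\<forall>\<epsilon>>0. \<tau>' \<epsilon> = \<tau> \<epsilon> / (\<rho> \<epsilon>)\<^sup>2) \<and>
       filterlim \<tau>' at_top (at_right 0)"
    if adm: "admissible_scaling \<alpha>1 \<tau> \<rho>" and R': "R' = (\<lambda>\<epsilon>. (\<lambda>x. \<rho> \<epsilon> *\<^sub>R x) ` R \<epsilon>)"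
      and \<tau>': "\<tau>' = (\<lambda>\<epsilon>. first_eigenvalue (R' \<epsilon>))" for \<rho> R' \<tau>'
  proof -
    have \<rho>: "\<rho> \<epsilon> > 0" if "\<epsilon> > 0" for \<epsilon>
      using adm that by (simp add: admissible_scaling_def)
    have lim: "filterlim \<rho> at_top (at_right 0)" "((\<lambda>\<epsilon>. \<alpha>1 powr (1 / \<epsilon>) * \<rho> \<epsilon>) \<longlongrightarrow> 0) (at_right 0)"
      "filterlim (\<lambda>\<epsilon>. \<tau> \<epsilon> / (\<rho> \<epsilon>)\<^sup>2) at_top (at_right 0)"
      using adm by (auto simp: admissible_scaling_def)
    have width: "0 < \<rho> \<epsilon> * g \<epsilon> (x / \<rho> \<epsilon>)" "\<rho> \<epsilon> * g \<epsilon> (x / \<rho> \<epsilon>) \<le> \<alpha>1 powr (1 / \<epsilon>) * \<rho> \<epsilon>"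
      if "\<epsilon> > 0" "x \<in> {0<..<\<rho> \<epsilon> * L}" for \<epsilon> x
    proof -
      have "x / \<rho> \<epsilon> \<in> {0..L}"
        using that \<rho>[OF that(1)] by (auto simp: field_simps)
      then show "0 < \<rho> \<epsilon> * g \<epsilon> (x / \<rho> \<epsilon>)" "\<rho> \<epsilon> * g \<epsilon> (x / \<rho> \<epsilon>) \<le> \<alpha>1 powr (1 / \<epsilon>) * \<rho> \<epsilon>"
        using g_le[OF that(1)] \<rho>[OF that(1)] by (auto simp: mult.commute[of "\<rho> \<epsilon>"])
    qed
    have \<tau>'_eq: "\<tau>' \<epsilon> = \<tau> \<epsilon> / (\<rho> \<epsilon>)\<^sup>2" if "\<epsilon> > 0" for \<epsilon>
      unfolding \<tau>' R' \<tau> using that by (intro first_eigenvalue_dilation \<rho> ne open_sets_lebesgue Ropen)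
    have "filterlim (\<lambda>\<epsilon>. \<rho> \<epsilon> * L) at_top (at_right 0)"
      using filterlim_tendsto_pos_mult_at_top[OF tendsto_const \<open>L > 0\<close> lim(1)] by (simp add: mult.commute)
    \<comment> \<open>Uniformity holds because the bound alpha1^(1/eps) rho_eps from
      \<open>width\<close> does not depend on x1.\<close>
    moreover have "\<forall>\<^sub>F \<epsilon> in at_right 0. \<forall>x\<in>{0<..<\<rho> \<epsilon> * L}. \<bar>\<rho> \<epsilon> * g \<epsilon> (x / \<rho> \<epsilon>)\<bar> < \<delta>" if "\<delta> > 0" for \<delta>
      using order_tendstoD(2)[OF lim(2) that] eventually_at_right_less[of 0]
    proof eventually_elim
      case (elim \<epsilon>)
      then show ?case
        using width[of \<epsilon>] by fastforce
    qed
    moreover have "filterlim \<tau>' at_top (at_right 0)"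
    proof (rule filterlim_mono_eventually[OF lim(3) order_refl order_refl])
      show "\<forall>\<^sub>F \<epsilon> in at_right 0. \<tau> \<epsilon> / (\<rho> \<epsilon>)\<^sup>2 = \<tau>' \<epsilon>"
        using eventually_at_right_less[of 0] by eventually_elim (simp add: \<tau>'_eq)
    qed
    moreover have "R' \<epsilon> = thin_domain (\<rho> \<epsilon> * L) (\<lambda>x1. \<rho> \<epsilon> * g \<epsilon> (x1 / \<rho> \<epsilon>))" if "\<epsilon> > 0" for \<epsilon>
      unfolding R' R by (rule thin_domain_dilation[OF \<rho>[OF that]])
    ultimately show ?thesis
      using width lim(2) \<tau>'_eq by blast
  qed
  ultimately show ?thesis
    by blast
qed

end
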